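(* Let $n>2k\ge 6$. Let $(S_1,T_1),\dots,(S_m,T_m)$ be all resistant pairs, indexed so that $T_1<T_2<\dots<T_m$, and put $T_0=[2,n]$, $S_0=\{1\}$ (so $\mathcal L(T_0,k)=\emptyset$ and $\mathcal L(S_0,k-1)=\binom{[2,n]}{k-1}$). Then: (i) for each $l\in[m]$, $|\mathcal L(S_{l-1},k-1)|+|\mathcal L(T_{l-1},k)|>|\mathcal L(S_l,k-1)|+|\mathcal L(T_l,k)|$; (ii) for each $l\in[m]$, every cross-intersecting pair $\mathcal A\subseteq\binom{[2,n]}{k-1}$, $\mathcal B\subseteq\binom{[2,n]}{k}$ with $|\mathcal L(T_{l-1},k)|<|\mathcal B|\le|\mathcal L(T_l,k)|$ satisfies $|\mathcal A|+|\mathcal B|\le|\mathcal L(S_l,k-1)|+|\mathcal L(T_l,k)|$; (iii) for each $l\in[m]$, every intersecting family $\mathcal F\subseteq\binom{[n]}{k}$ with $|\mathcal L(T_{l-1},k)|<\gamma(\mathcal F)\le|\mathcal L(T_l,k)|$ satisfies $|\mathcal F|\le|\mathcal L(S_l,k-1)|+|\mathcal L(T_l,k)|$.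
   Context: $[a,b]=\{a,\dots,b\}$, $[j]=\{1,\dots,j\}$. Families $\mathcal A,\mathcal B$ are cross-intersecting if $A\cap B\neq\emptyset$ for all $A\in\mathcal A$, $B\in\mathcal B$; a family is intersecting if any two of its sets intersect. For $\mathcal F\subseteq\binom{[n]}{k}$, $\Delta(\mathcal F)$ is the maximal number of sets of $\mathcal F$ containing a common element and $\gamma(\mathcal F)=|\mathcal F|-\Delta(\mathcal F)$ is the diversity. Lexicographic order: for distinct finite sets $A,B\subseteq[n]$, $A<B$ iff $\min(A\triangle B)\in A$ (so in particular $A<B$ whenever $A\supsetneq B$); $A\le B$ means $A<B$ or $A=B$. For $X\subseteq[n]$ and an integer $a$, $\mathcal L(X,a)=\{A\in\binom{[2,n]}{a}: A\le X\cap[2,n]\}$. A pair of sets $S\subseteq[n]$, $T\subseteq[2,n]$ (with $T\neq\emptyset$, $j=\max T$) is a resistant pair if (1) $S\cap T=\{j\}$, $S\cup T=[j]$, $|S|\le k$, $|T|\le k$; and (2) for each $4\le i\le j$, $|[i]\cap S|<|[i]\setminus S|$; in addition, by convention, the pair $S=\{1,4\}$, $T=\{2,3,4\}$ is declared resistant. (Each $T$ determines $S$.)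
   Formalization: Resistant pairs are required to have j = max T ≥ 4, so T = {2}, {3}, {2,3}, which satisfy condition (2) only vacuously, are excluded; with them (i) fails, e.g. for n=7, k=3 the sets {2,3,4} and {2,3} give equal sums 13. *)

theory Defs
  imports "HOL-Library.Ramsey"
begin

text \<open>The $k$-element subsets of \<open>A\<close> are the library's \<open>nsets A k\<close>.\<close>

definition cross_intersecting :: "nat set set \<Rightarrow> nat set set \<Rightarrow> bool" where
  "cross_intersecting \<A> \<B> \<longleftrightarrow> (\<forall>A\<in>\<A>. \<forall>B\<in>\<B>. A \<inter> B \<noteq> {})"

definition intersecting :: "nat set set \<Rightarrow> bool" where
  "intersecting \<F> \<longleftrightarrow> (\<forall>A\<in>\<F>. \<forall>B\<in>\<F>. A \<inter> B \<noteq> {})"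

definition max_degree :: "nat \<Rightarrow> nat set set \<Rightarrow> nat" where
  "max_degree n \<F> = Max ((\<lambda>x. card {F \<in> \<F>. x \<in> F}) ` {1..n})"

text \<open>No truncation happens in the subtraction: a degree in a finite family is at most its size.\<close>

definition diversity :: "nat \<Rightarrow> nat set set \<Rightarrow> nat" where
  "diversity n \<F> = card \<F> - max_degree n \<F>"

text \<open>
  For finite sets. Unlike the dictionary order on increasing lists, a proper superset precedes its
  subsets.
\<close>

definition lex_less :: "nat set \<Rightarrow> nat set \<Rightarrow> bool" where
  "lex_less A B \<longleftrightarrow> A \<noteq> B \<and> Min (sym_diff A B) \<in> A"

definition lex_le :: "nat set \<Rightarrow> nat set \<Rightarrow> bool" where
  "lex_le A B \<longleftrightarrow> lex_less A B \<or> A = B"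

definition lex_family :: "nat \<Rightarrow> nat set \<Rightarrow> nat \<Rightarrow> nat set set" where
  "lex_family n X a = {A \<in> nsets {2..n} a. lex_le A (X \<inter> {2..n})}"

text \<open>
  The requirement \<open>4 \<le> Max T\<close> makes explicit that the prefix condition is not meant to hold
  vacuously when \<open>Max T < 4\<close>: it is what remains, for such \<open>T\<close>, of demanding the
  prefix inequality for every \<open>i \<ge> 4\<close> (which for \<open>i > Max T \<ge> 4\<close> follows from the case
  \<open>i = Max T\<close>). It excludes exactly \<open>T = {2}, {3}, {2, 3}\<close>; for instance
  \<open>({1, 3}, {2, 3})\<close> and \<open>({1, 4}, {2, 3, 4})\<close> give
  lexicographic families of the same total size.
\<close>

definition resistant_pair :: "nat \<Rightarrow> nat \<Rightarrow> nat set \<Rightarrow> nat set \<Rightarrow> bool" where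
  "resistant_pair n k S T \<longleftrightarrow>
     S \<subseteq> {1..n} \<and> T \<subseteq> {2..n} \<and> T \<noteq> {} \<and>
     ((S \<inter> T = {Max T} \<and> S \<union> T = {1..Max T} \<and> card S \<le> k \<and> card T \<le> k \<and>
       4 \<le> Max T \<and> (\<forall>i. 4 \<le> i \<and> i \<le> Max T \<longrightarrow> card ({1..i} \<inter> S) < card ({1..i} - S)))
      \<or> (S = {1, 4} \<and> T = {2, 3, 4}))"

end

theory Submission
  imports Defs "HOL.Binomial_Plus"
begin

text \<open>
  Compressing both families simultaneously reduces (ii) to lexicographic initial segments. For an
  initial segment \<open>\<B>\<close>, a \<open>(k - 1)\<close>-set \<open>Y\<close> meets all of \<open>\<B>\<close> iff the \<open>k\<close> smallest elements of
  \<open>{2..n} - Y\<close> do not form a member of \<open>\<B>\<close>. So the maximal total size is a constant plus the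
  surplus of \<open>\<B>\<close>, and the surplus is additive. On the family of all \<open>k\<close>-sets with a given trace
  \<open>p\<close> on \<open>[i]\<close> it is a difference of two binomial coefficients, with the sign of
  \<open>i - 2 * card p\<close>; that sign is what resistance controls. Between consecutive resistant sets
  there are only traces of surplus 0 and one of negative surplus, which is (i). A set \<open>R\<close>
  whose next resistant set is \<open>T\<close> has a trace with \<open>i = 2 * card p\<close>, inside which replacing \<open>R\<close>
  by the last set is no loss by regularity of the disjointness graph; from there up to \<open>T\<close> only
  traces of nonnegative surplus are added, which gives (ii). Finally (iii) is (ii) for the sets
  containing, respectively avoiding, an element of maximal degree.
\<close>

section \<open>Compression to lexicographic initial segments\<close>

lemma lex_less_iff:
  assumes "finite A" "finite B"
  shows "lex_less A B \<longleftrightarrow> (\<exists>d\<in>A. d \<notin> B \<and> A \<inter> {..<d} = B \<inter> {..<d})"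
proof
  assume "lex_less A B"
  then have ne: "A \<noteq> B" and m: "Min (sym_diff A B) \<in> A" by (auto simp: lex_less_def)
  have fin: "finite (sym_diff A B)" using assms by auto
  have "Min (sym_diff A B) \<in> sym_diff A B" using ne by (intro Min_in fin) auto
  moreover have "x \<notin> sym_diff A B" if "x < Min (sym_diff A B)" for x
    using that fin by (meson Min_le not_le)
  ultimately show "\<exists>d\<in>A. d \<notin> B \<and> A \<inter> {..<d} = B \<inter> {..<d}"
    using m by (intro bexI[of _ "Min (sym_diff A B)"]) auto
next
  assume "\<exists>d\<in>A. d \<notin> B \<and> A \<inter> {..<d} = B \<inter> {..<d}"
  then obtain d where d: "d \<in> A" "d \<notin> B" "A \<inter> {..<d} = B \<inter> {..<d}" by auto
  have "Min (sym_diff A B) = d"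
  proof (rule Min_eqI)
    show "finite (sym_diff A B)" using assms by auto
    show "d \<le> y" if "y \<in> sym_diff A B" for y
      using that d(3) by (metis Diff_iff IntI Int_iff Un_iff lessThan_iff not_le)
  qed (use d in auto)
  with d show "lex_less A B" by (auto simp: lex_less_def)
qed

lemma lex_lessI:
  assumes "finite A" "finite B" "d \<in> A" "d \<notin> B" "A \<inter> {..<d} = B \<inter> {..<d}"
  shows "lex_less A B"
  using assms lex_less_iff by blast

lemma lex_lessE:
  assumes "lex_less A B" "finite A" "finite B"
  obtains d where "d \<in> A" "d \<notin> B" "A \<inter> {..<d} = B \<inter> {..<d}"
  using assms lex_less_iff by blast

lemma lex_less_irrefl [simp]: "\<not> lex_less A A"
  by (simp add: lex_less_def)

lemma lex_less_trans:
  assumes "lex_less A B" "lex_less B C" "finite A" "finite B" "finite C"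
  shows "lex_less A C"
proof -
  obtain d where d: "d \<in> A" "d \<notin> B" "A \<inter> {..<d} = B \<inter> {..<d}"
    using assms lex_lessE by metis
  obtain e where e: "e \<in> B" "e \<notin> C" "B \<inter> {..<e} = C \<inter> {..<e}"
    using assms lex_lessE by metis
  have mono: "A' \<inter> {..<min d e} = B' \<inter> {..<min d e}"
    if "A' \<inter> {..<f} = B' \<inter> {..<f}" "f = d \<or> f = e" for A' B' f
    using that by (auto simp: set_eq_iff)
  have eq: "A \<inter> {..<min d e} = C \<inter> {..<min d e}"
    using mono[OF d(3)] mono[OF e(3)] by simp
  have "min d e \<in> A \<and> min d e \<notin> C"
  proof (cases d e rule: linorder_cases)
    case less then show ?thesis using d e by (auto simp: min_def)
  next
    case equal then show ?thesis using d e by auto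
  next
    case greater then show ?thesis using d e by (auto simp: min_def)
  qed
  then show ?thesis using eq assms lex_lessI by blast
qed

lemma lex_less_linear:
  assumes "finite A" "finite B"
  shows "A = B \<or> lex_less A B \<or> lex_less B A"
proof (cases "A = B")
  case False
  have "Min (sym_diff A B) \<in> sym_diff A B" using assms False by (intro Min_in) auto
  moreover have "sym_diff A B = sym_diff B A" by auto
  ultimately show ?thesis by (auto simp: lex_less_def)
qed simp

lemma lex_less_asym:
  assumes "lex_less A B" "finite A" "finite B"
  shows "\<not> lex_less B A"
  using lex_less_trans[OF assms(1) _ assms(2,3,2)] by auto

lemma lex_le_iff_not_less:
  assumes "finite A" "finite B"
  shows "lex_le A B \<longleftrightarrow> \<not> lex_less B A"
  using assms lex_less_linear lex_less_asym by (metis lex_le_def lex_less_irrefl)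

lemma lex_le_trans:
  assumes "lex_le A B" "lex_le B C" "finite A" "finite B" "finite C"
  shows "lex_le A C"
  using assms lex_less_trans by (metis lex_le_def)

lemma lex_le_less_trans:
  assumes "lex_le A B" "lex_less B C" "finite A" "finite B" "finite C"
  shows "lex_less A C"
  using assms lex_less_trans by (metis lex_le_def)

lemma lex_less_le_trans:
  assumes "lex_less A B" "lex_le B C" "finite A" "finite B" "finite C"
  shows "lex_less A C"
  using assms lex_less_trans by (metis lex_le_def)

text \<open>To precede \<open>A\<close>, the set \<open>B\<close> would need an element outside
  \<open>A\<close>. The main use is to compare a set with its own prefixes
  \<open>R \<inter> {..i}\<close>, which come no earlier than \<open>R\<close>.\<close>

lemma superset_lex_le:
  assumes "B \<subseteq> A" "finite A"
  shows "lex_le A B"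
proof -
  have "finite B" using assms finite_subset by auto
  then have "\<not> lex_less B A" using assms by (auto elim!: lex_lessE)
  then show ?thesis using assms \<open>finite B\<close> lex_le_iff_not_less by auto
qed

lemma finite_nsets_elem: "X \<in> nsets A r \<Longrightarrow> finite X"
  by (simp add: nsets_def)

section \<open>UV-compressions towards the front of the order\<close>

definition lex_initial :: "nat set \<Rightarrow> nat \<Rightarrow> nat set set \<Rightarrow> bool" where
  "lex_initial G r \<A> \<longleftrightarrow> \<A> \<subseteq> nsets G r \<and>
     (\<forall>X\<in>\<A>. \<forall>Z\<in>nsets G r. lex_less Z X \<longrightarrow> Z \<in> \<A>)"

text \<open>The admissible pairs for a UV-compression. Since the least element of
  \<open>U \<union> V\<close> lies in \<open>U\<close>, replacing \<open>V\<close> by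
  \<open>U\<close> is a move to an earlier set.\<close>

definition shiftable :: "nat set \<Rightarrow> nat set \<Rightarrow> bool" where
  "shiftable U V \<longleftrightarrow> finite U \<and> finite V \<and> card U = card V \<and> U \<inter> V = {} \<and>
     (\<exists>u\<in>U. \<forall>x\<in>U \<union> V. u \<le> x)"

definition replace :: "nat set \<Rightarrow> nat set \<Rightarrow> nat set \<Rightarrow> nat set" where
  "replace U V X = (X - V) \<union> U"

definition movable :: "nat set \<Rightarrow> nat set \<Rightarrow> nat set set \<Rightarrow> nat set set" where
  "movable U V \<A> = {X \<in> \<A>. V \<subseteq> X \<and> U \<inter> X = {} \<and> replace U V X \<notin> \<A>}"

definition compress :: "nat set \<Rightarrow> nat set \<Rightarrow> nat set set \<Rightarrow> nat set set" where
  "compress U V \<A> = (\<A> - movable U V \<A>) \<union> replace U V ` movable U V \<A>"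

text \<open>Keep the least element of \<open>U\<close> and add others up to the size of
  \<open>V1\<close>. This supplies the inner pairs whose stability
  \<open>compress_moved_meets\<close> exploits.\<close>

lemma shiftable_subset:
  assumes "shiftable U V" "V1 \<subseteq> V" "V1 \<noteq> {}"
  obtains U1 where "U1 \<subseteq> U" "card U1 = card V1" "shiftable U1 V1"
proof -
  obtain u where u: "u \<in> U" "\<forall>x\<in>U \<union> V. u \<le> x" using assms(1) by (auto simp: shiftable_def)
  have fin: "finite U" "finite V" "card U = card V" "U \<inter> V = {}"
    using assms by (auto simp: shiftable_def)
  have finV1: "finite V1" using fin assms finite_subset by auto
  then have "card V1 \<ge> 1" using assms(3) by (simp add: Suc_leI card_gt_0_iff)
  moreover have "card V1 \<le> card U" using fin assms card_mono by metis
  ultimately have "card V1 - 1 \<le> card (U - {u})" using u fin by simp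
  then obtain W where W: "W \<subseteq> U - {u}" "card W = card V1 - 1"
    using obtain_subset_with_card_n by metis
  have "finite W" using W fin finite_subset by blast
  moreover have "u \<notin> W" using W by auto
  ultimately have "card (insert u W) = card V1" using W \<open>card V1 \<ge> 1\<close> by simp
  moreover have "insert u W \<subseteq> U" using u W by auto
  moreover have "shiftable (insert u W) V1"
    unfolding shiftable_def using calculation \<open>finite W\<close> finV1 fin u assms(2) by auto
  ultimately show thesis using that by blast
qed

lemma compress_subset:
  assumes "\<A> \<subseteq> nsets G r" "shiftable U V" "U \<subseteq> G" "V \<subseteq> G"
  shows "compress U V \<A> \<subseteq> nsets G r"
proof -
  have "replace U V X \<in> nsets G r" if "X \<in> movable U V \<A>" for X
  proof -
    have X: "X \<subseteq> G" "finite X" "card X = r" "V \<subseteq> X" "U \<inter> X = {}"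
      using that assms by (auto simp: movable_def nsets_def)
    have "card ((X - V) \<union> U) = card (X - V) + card U"
      using X assms by (intro card_Un_disjoint) (auto simp: shiftable_def)
    also have "\<dots> = r"
      using X assms card_mono[of X V] by (simp add: card_Diff_subset shiftable_def)
    finally show ?thesis using X assms by (auto simp: replace_def nsets_def shiftable_def)
  qed
  then show ?thesis using assms by (auto simp: compress_def)
qed

lemma inj_on_replace: "inj_on (replace U V) (movable U V \<A>)"
proof (rule inj_onI)
  fix X Y assume "X \<in> movable U V \<A>" "Y \<in> movable U V \<A>" and eq: "replace U V X = replace U V Y"
  then have "X = (replace U V X - U) \<union> V" "Y = (replace U V Y - U) \<union> V"
    by (auto simp: movable_def replace_def)
  with eq show "X = Y" by simp
qed

text \<open>The weight is arbitrary because it serves twice: weight 1 shows that sizes are kept,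
  \<open>lex_rank\<close> that the potential drops.\<close>

lemma sum_compress:
  fixes f :: "nat set \<Rightarrow> nat"
  assumes "finite \<A>"
  shows "sum f (compress U V \<A>)
    = sum f (\<A> - movable U V \<A>) + (\<Sum>X\<in>movable U V \<A>. f (replace U V X))"
proof -
  have "finite (movable U V \<A>)" using assms by (simp add: movable_def)
  moreover have "(\<A> - movable U V \<A>) \<inter> replace U V ` movable U V \<A> = {}"
    by (auto simp: movable_def)
  ultimately have "sum f (compress U V \<A>)
      = sum f (\<A> - movable U V \<A>) + sum f (replace U V ` movable U V \<A>)"
    unfolding compress_def using assms by (intro sum.union_disjoint) auto
  then show ?thesis by (simp add: sum.reindex[OF inj_on_replace])
qed

lemma card_compress:
  assumes "finite \<A>"
  shows "card (compress U V \<A>) = card \<A>"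
proof -
  have sub: "movable U V \<A> \<subseteq> \<A>" by (auto simp: movable_def)
  have "card (compress U V \<A>) = card (\<A> - movable U V \<A>) + card (movable U V \<A>)"
    using sum_compress[OF assms, of "\<lambda>_. 1" U V] by simp
  also have "\<dots> = card \<A>"
    using sub assms by (simp add: card_Diff_subset card_mono finite_subset)
  finally show ?thesis .
qed

lemma replace_lex_less:
  assumes "shiftable U V" "finite X" "V \<subseteq> X" "U \<inter> X = {}"
  shows "lex_less (replace U V X) X"
proof -
  obtain u where u: "u \<in> U" "\<forall>x\<in>U \<union> V. u \<le> x" using assms(1) by (auto simp: shiftable_def)
  have "x \<notin> U \<union> V" if "x < u" for x using u that by (meson leD)
  then show ?thesis
    using u assms by (intro lex_lessI[of _ _ u]) (auto simp: replace_def shiftable_def)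
qed

text \<open>The count runs over all subsets of \<open>G\<close> and not those of one size, so one
  potential serves both families of a pair.\<close>

definition lex_rank :: "nat set \<Rightarrow> nat set \<Rightarrow> nat" where
  "lex_rank G X = card {Z \<in> Pow G. lex_less Z X}"

lemma lex_rank_less:
  assumes "finite G" "X \<subseteq> G" "Y \<subseteq> G" "lex_less X Y"
  shows "lex_rank G X < lex_rank G Y"
  unfolding lex_rank_def
proof (rule psubset_card_mono)
  show "finite {Z \<in> Pow G. lex_less Z Y}" using assms by auto
  have "lex_less Z Y" if "Z \<subseteq> G" "lex_less Z X" for Z
    using that assms lex_less_trans finite_subset by metis
  then have "{Z \<in> Pow G. lex_less Z X} \<subseteq> {Z \<in> Pow G. lex_less Z Y}" by auto
  moreover have "X \<in> {Z \<in> Pow G. lex_less Z Y} - {Z \<in> Pow G. lex_less Z X}" using assms by auto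
  ultimately show "{Z \<in> Pow G. lex_less Z X} \<subset> {Z \<in> Pow G. lex_less Z Y}" by blast
qed

lemma cross_intersecting_commute: "cross_intersecting \<A> \<B> \<longleftrightarrow> cross_intersecting \<B> \<A>"
  unfolding cross_intersecting_def by (metis Int_commute)

text \<open>
  If \<open>X\<close> has just been moved while \<open>Y\<close> stayed, then replacing \<open>Y \<inter> V\<close> inside \<open>Y\<close> by part of
  \<open>U\<close> -- a move under which \<open>\<A>\<close> is already stable -- produces a member of \<open>\<A>\<close> disjoint from the
  original of \<open>X\<close>.
\<close>

lemma compress_moved_meets:
  assumes cross: "cross_intersecting \<A> \<B>"
    and sh: "shiftable U V"
    and stable: "\<And>U1 V1. shiftable U1 V1 \<Longrightarrow> U1 \<subseteq> U \<Longrightarrow> V1 \<subseteq> V \<Longrightarrow> card V1 < card V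
                   \<Longrightarrow> movable U1 V1 \<A> = {}"
    and X: "X \<in> movable U V \<B>" and Y: "Y \<in> \<A> - movable U V \<A>"
  shows "Y \<inter> replace U V X \<noteq> {}"
proof
  assume disj: "Y \<inter> replace U V X = {}"
  have X': "X \<in> \<B>" "V \<subseteq> X" "U \<inter> X = {}" using X by (auto simp: movable_def)
  have YU: "Y \<inter> U = {}" and YX: "Y \<inter> (X - V) = {}" using disj by (auto simp: replace_def)
  have "Y \<inter> X \<noteq> {}" using cross X' Y by (auto simp: cross_intersecting_def)
  then have ne: "Y \<inter> V \<noteq> {}" using YX by auto
  obtain U1 where U1: "U1 \<subseteq> U" "card U1 = card (Y \<inter> V)" "shiftable U1 (Y \<inter> V)"
    using shiftable_subset[OF sh _ ne] by auto
  have fin: "finite U" "finite V" "card U = card V" using sh by (auto simp: shiftable_def)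
  have "replace U1 (Y \<inter> V) Y \<in> \<A>"
  \<comment> \<open>If \<open>V \<subseteq> Y\<close>, sizes force \<open>U1 = U\<close>, and
    \<open>Y\<close> stayed in place only because its image was present already. Otherwise the pair
    is strictly smaller and \<open>stable\<close> applies.\<close>
  proof (cases "V \<subseteq> Y")
    case True
    then have "Y \<inter> V = V" by auto
    then have "U1 = U" using U1 fin by (metis card_subset_eq)
    with True \<open>Y \<inter> V = V\<close> Y YU show ?thesis by (auto simp: movable_def)
  next
    case False
    then have "card (Y \<inter> V) < card V" using fin by (intro psubset_card_mono) auto
    then have "movable U1 (Y \<inter> V) \<A> = {}" using stable[OF U1(3,1)] by auto
    moreover have "U1 \<inter> Y = {}" using U1 YU by auto
    ultimately show ?thesis using Y by (auto simp: movable_def)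
  qed
  moreover have "replace U1 (Y \<inter> V) Y \<inter> X = {}"
    using U1 X' YX by (auto simp: replace_def)
  ultimately show False using cross X' by (auto simp: cross_intersecting_def)
qed

text \<open>Two original members meet as before, two moved ones share \<open>U \<noteq> {}\<close>,
  and the mixed pairs are \<open>compress_moved_meets\<close>, used once in each order.\<close>

lemma compress_cross_intersecting:
  assumes cross: "cross_intersecting \<A> \<B>"
    and sh: "shiftable U V"
    and stable: "\<And>U1 V1. shiftable U1 V1 \<Longrightarrow> U1 \<subseteq> U \<Longrightarrow> V1 \<subseteq> V \<Longrightarrow> card V1 < card V
                   \<Longrightarrow> movable U1 V1 \<A> = {} \<and> movable U1 V1 \<B> = {}"
  shows "cross_intersecting (compress U V \<A>) (compress U V \<B>)"
  unfolding cross_intersecting_def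
proof (intro ballI)
  fix Y X assume Y: "Y \<in> compress U V \<A>" and X: "X \<in> compress U V \<B>"
  have "U \<noteq> {}" using sh by (auto simp: shiftable_def)
  consider "Y \<in> \<A>" "X \<in> \<B>"
    | Y' X' where "Y = replace U V Y'" "X = replace U V X'"
    | X' where "Y \<in> \<A> - movable U V \<A>" "X' \<in> movable U V \<B>" "X = replace U V X'"
    | Y' where "X \<in> \<B> - movable U V \<B>" "Y' \<in> movable U V \<A>" "Y = replace U V Y'"
    using X Y by (auto simp: compress_def)
  then show "Y \<inter> X \<noteq> {}"
  proof cases
    case 1 then show ?thesis using cross by (auto simp: cross_intersecting_def)
  next
    case 2 then show ?thesis using \<open>U \<noteq> {}\<close> by (auto simp: replace_def)
  next
    case 3 then show ?thesis using compress_moved_meets[OF cross sh] stable by blast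
  next
    case 4
    have "X \<inter> replace U V Y' \<noteq> {}"
      using 4 stable cross by (intro compress_moved_meets[of \<B> \<A>])
        (auto simp: cross_intersecting_commute sh)
    then show ?thesis using 4 by auto
  qed
qed

text \<open>Among the cross-intersecting pairs of the given sizes, one of least total rank is moved
  by no compression, and a family fixed by all compressions is an initial segment.\<close>

lemma cross_intersecting_lex_initial:
  assumes "finite G" "\<A> \<subseteq> nsets G r" "\<B> \<subseteq> nsets G s" "cross_intersecting \<A> \<B>"
  obtains \<A>' \<B>' where "lex_initial G r \<A>'" "lex_initial G s \<B>'"
    "card \<A>' = card \<A>" "card \<B>' = card \<B>" "cross_intersecting \<A>' \<B>'"
proof -
  let ?P = "\<lambda>(\<A>', \<B>'). \<A>' \<subseteq> nsets G r \<and> \<B>' \<subseteq> nsets G s \<and> card \<A>' = card \<A> \<and>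
     card \<B>' = card \<B> \<and> cross_intersecting \<A>' \<B>'"
  let ?w = "\<lambda>(\<A>', \<B>'). sum (lex_rank G) \<A>' + sum (lex_rank G) \<B>'"
  have "?P (\<A>, \<B>)" using assms by simp
  then have "\<exists>p. ?P p \<and> (\<forall>q. ?P q \<longrightarrow> ?w p \<le> ?w q)" by (rule ex_has_least_nat)
  then obtain p where p: "?P p" "\<forall>q. ?P q \<longrightarrow> ?w p \<le> ?w q" by (elim exE conjE)
  obtain \<A>' \<B>' where pair: "p = (\<A>', \<B>')" by (cases p)
  have A: "\<A>' \<subseteq> nsets G r" and B: "\<B>' \<subseteq> nsets G s" and
    cards: "card \<A>' = card \<A>" "card \<B>' = card \<B>" and cross: "cross_intersecting \<A>' \<B>'"
    using p pair by auto
  have finn: "finite (nsets G t)" for t using assms by (simp add: finite_imp_finite_nsets)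
  have finA: "finite \<A>'" and finB: "finite \<B>'" using A B finn finite_subset by metis+
  have moved: "lex_rank G (replace U V X) < lex_rank G X"
    if "shiftable U V" "U \<subseteq> G" "V \<subseteq> G" "X \<in> movable U V \<C>" "\<C> \<subseteq> nsets G t" for U V X \<C> t
    using that assms by (intro lex_rank_less replace_lex_less)
      (auto simp: movable_def nsets_def replace_def)
  have decr: "sum (lex_rank G) (compress U V \<C>) \<le> sum (lex_rank G) \<C>"
      "movable U V \<C> \<noteq> {} \<Longrightarrow> sum (lex_rank G) (compress U V \<C>) < sum (lex_rank G) \<C>"
    if "shiftable U V" "U \<subseteq> G" "V \<subseteq> G" "\<C> \<subseteq> nsets G t" for U V \<C> t
  proof -
    have fin: "finite \<C>" using that finn finite_subset by metis
    have sub: "movable U V \<C> \<subseteq> \<C>" by (auto simp: movable_def)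
    then have finm: "finite (movable U V \<C>)" using fin finite_subset by auto
    have split: "sum (lex_rank G) \<C> = sum (lex_rank G) (\<C> - movable U V \<C>)
                   + sum (lex_rank G) (movable U V \<C>)"
      using fin sub by (simp add: sum.subset_diff)
    show "sum (lex_rank G) (compress U V \<C>) \<le> sum (lex_rank G) \<C>"
      unfolding split sum_compress[OF fin]
      using moved that by (intro add_left_mono sum_mono) (meson less_imp_le)
    show "sum (lex_rank G) (compress U V \<C>) < sum (lex_rank G) \<C>" if "movable U V \<C> \<noteq> {}"
      unfolding split sum_compress[OF fin]
      using moved \<open>shiftable U V\<close> \<open>U \<subseteq> G\<close> \<open>V \<subseteq> G\<close> \<open>\<C> \<subseteq> nsets G t\<close> that finm
      by (intro add_strict_left_mono sum_strict_mono) auto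
  qed
  \<comment> \<open>Induction on \<open>card V\<close>: stability under smaller pairs is what keeps
    the compressed pair cross-intersecting, so it competes with \<open>p\<close>, and a genuine move
    would lower the total rank.\<close>
  have stable: "movable U V \<A>' = {} \<and> movable U V \<B>' = {}"
    if "shiftable U V" "U \<subseteq> G" "V \<subseteq> G" for U V
    using that
  proof (induction "card V" arbitrary: U V rule: less_induct)
    case less
    have "cross_intersecting (compress U V \<A>') (compress U V \<B>')"
      using less by (intro compress_cross_intersecting cross) (metis subset_trans)+
    then have "?P (compress U V \<A>', compress U V \<B>')"
      using less.prems A B cards finA finB by (simp add: compress_subset card_compress)
    then have "?w p \<le> ?w (compress U V \<A>', compress U V \<B>')" by (rule mp[OF spec[OF p(2)]])
    then have "\<not> sum (lex_rank G) (compress U V \<A>') < sum (lex_rank G) \<A>'"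
        "\<not> sum (lex_rank G) (compress U V \<B>') < sum (lex_rank G) \<B>'"
      using decr(1)[OF less.prems A] decr(1)[OF less.prems B] by (auto simp: pair)
    then show ?case using decr(2)[OF less.prems A] decr(2)[OF less.prems B] by blast
  qed
  \<comment> \<open>If \<open>Z\<close> precedes \<open>X\<close>, exchanging \<open>X - Z\<close>
    for \<open>Z - X\<close> is an admissible move. It takes \<open>X\<close> to \<open>Z\<close>,
    so \<open>Z\<close> must be present already.\<close>
  have init: "lex_initial G t \<C>" if sub: "\<C> \<subseteq> nsets G t"
    and st: "\<And>U V. shiftable U V \<Longrightarrow> U \<subseteq> G \<Longrightarrow> V \<subseteq> G \<Longrightarrow> movable U V \<C> = {}" for t \<C>
    unfolding lex_initial_def
  proof (intro conjI ballI impI sub)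
    fix X Z assume X: "X \<in> \<C>" and Z: "Z \<in> nsets G t" and lt: "lex_less Z X"
    have *: "finite X" "finite Z" "X \<subseteq> G" "Z \<subseteq> G" "card X = card Z"
      using X Z sub by (auto simp: nsets_def)
    obtain d where d: "d \<in> Z" "d \<notin> X" "Z \<inter> {..<d} = X \<inter> {..<d}"
      using lex_lessE[OF lt] * by metis
    have "d \<le> x" if "x \<in> (Z - X) \<union> (X - Z)" for x
      using that d(3) by (metis Diff_iff IntI Int_iff Un_iff lessThan_iff not_le)
    moreover have "card (Z - X) = card (X - Z)" using * by (simp add: card_le_sym_Diff le_antisym)
    ultimately have "shiftable (Z - X) (X - Z)"
      unfolding shiftable_def using * d by (intro conjI bexI[of _ d]) auto
    then have "movable (Z - X) (X - Z) \<C> = {}" using st * by auto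
    moreover have "replace (Z - X) (X - Z) X = Z" by (auto simp: replace_def)
    ultimately show "Z \<in> \<C>" using X by (auto simp: movable_def)
  qed
  have "lex_initial G r \<A>'" using stable by (intro init[OF A]) simp
  moreover have "lex_initial G s \<B>'" using stable by (intro init[OF B]) simp
  ultimately show thesis using cards cross by (rule that)
qed

section \<open>The surplus of a family\<close>

definition first_elems :: "nat \<Rightarrow> nat set \<Rightarrow> nat set" where
  "first_elems k A = {x \<in> A. card (A \<inter> {..x}) \<le> k}"

lemma first_elems_Int: "first_elems k A \<inter> {..i} = first_elems k (A \<inter> {..i})"
proof -
  have "A \<inter> {..i} \<inter> {..x} = A \<inter> {..x}" if "x \<le> i" for x using that by auto
  then show ?thesis by (auto simp: first_elems_def)
qed

lemma first_elems_self:
  assumes "finite A" "card A \<le> k"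
  shows "first_elems k A = A"
proof -
  have "card (A \<inter> {..x}) \<le> k" for x using assms card_mono[of A "A \<inter> {..x}"] by auto
  then show ?thesis by (auto simp: first_elems_def)
qed

lemma card_first_elems:
  assumes "finite A"
  shows "card (first_elems k A) = min k (card A)"
  using assms
proof (induction A rule: finite_linorder_max_induct)
  case empty then show ?case by (simp add: first_elems_def)
next
  case (insert b A)
  have b: "b \<notin> A" using insert by auto
  have "insert b A \<inter> {..x} = A \<inter> {..x}" if "x \<in> A" for x using that insert by auto
  moreover have "insert b A \<inter> {..b} = insert b A" using insert by auto
  ultimately have "first_elems k (insert b A)
      = first_elems k A \<union> (if Suc (card A) \<le> k then {b} else {})"
    using insert b by (auto simp: first_elems_def)
  moreover have "b \<notin> first_elems k A" "finite (first_elems k A)"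
    using insert b by (auto simp: first_elems_def)
  ultimately show ?case using insert b by auto
qed

text \<open>The condition on \<open>p\<close> ensures that \<open>A\<close> has at most
  \<open>k\<close> elements up to \<open>i\<close>, so nothing is cut off there. For
  \<open>card p = k\<close> with \<open>i \<notin> p\<close>, further elements of \<open>A\<close>
  could hide between the last one of \<open>p\<close> and \<open>i\<close>.\<close>

lemma first_elems_prefix_iff:
  assumes "finite A" "card p < k \<or> (card p = k \<and> i \<in> p)"
  shows "first_elems k A \<inter> {..i} = p \<longleftrightarrow> A \<inter> {..i} = p"
proof -
  let ?B = "A \<inter> {..i}"
  have fin: "finite ?B" using assms by auto
  have "card ?B \<le> k" if eq: "first_elems k ?B = p"
  proof (cases "card p < k")
    case True
    then show ?thesis using card_first_elems[OF fin, of k] eq by auto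
  next
    case False
    then have "i \<in> first_elems k ?B" using assms eq by auto
    then show ?thesis by (simp add: first_elems_def Int_assoc)
  qed
  moreover have "card ?B \<le> k" if "?B = p" using that assms by auto
  ultimately show ?thesis unfolding first_elems_Int using first_elems_self[OF fin] by auto
qed

text \<open>If \<open>X\<close> came first, the disagreement would be at some
  \<open>d \<in> X\<close> of rank above \<open>k\<close> in \<open>A\<close>. Then \<open>X\<close>
  would contain \<open>d\<close> besides all \<open>k\<close> elements of
  \<open>first_elems k A\<close>.\<close>

lemma first_elems_lex_le:
  assumes "finite A" "X \<subseteq> A" "card X = k"
  shows "lex_le (first_elems k A) X"
proof -
  have fin: "finite X" "finite (first_elems k A)"
    using assms finite_subset by (auto simp: first_elems_def)
  have "\<not> lex_less X (first_elems k A)"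
  proof
    assume "lex_less X (first_elems k A)"
    then obtain d where d: "d \<in> X" "d \<notin> first_elems k A"
      "X \<inter> {..<d} = first_elems k A \<inter> {..<d}" using fin lex_lessE by metis
    have "card (first_elems k A \<inter> {..d}) = min k (card (A \<inter> {..d}))"
      unfolding first_elems_Int using assms by (intro card_first_elems) auto
    moreover have "card (A \<inter> {..d}) > k" using d assms by (auto simp: first_elems_def)
    moreover have "first_elems k A \<inter> {..d} = first_elems k A \<inter> {..<d}"
      using d(2) by (auto simp: order_le_less)
    ultimately have "card (X \<inter> {..<d}) = k" using d(3) by simp
    moreover have "card (X \<inter> {..<d}) < card X"
      using fin d by (intro psubset_card_mono) auto
    ultimately show False using assms by simp
  qed
  then show ?thesis using lex_le_iff_not_less fin by auto
qed

definition first_disjoint :: "nat \<Rightarrow> nat \<Rightarrow> nat set \<Rightarrow> nat set" where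
  "first_disjoint n k Y = first_elems k ({2..n} - Y)"

lemma first_disjoint_nsets:
  assumes "n > 2 * k" "k \<ge> 1" "Y \<in> nsets {2..n} (k - 1)"
  shows "first_disjoint n k Y \<in> nsets {2..n} k"
proof -
  have "card ({2..n} - Y) = card {2..n} - card Y"
    using assms by (intro card_Diff_subset) (auto simp: nsets_def)
  then have "card ({2..n} - Y) = n - k" using assms by (simp add: nsets_def)
  then have "card (first_disjoint n k Y) = k"
    unfolding first_disjoint_def using assms by (subst card_first_elems) auto
  moreover have "first_disjoint n k Y \<subseteq> {2..n}" by (auto simp: first_disjoint_def first_elems_def)
  ultimately show ?thesis using finite_subset by (auto simp: nsets_def)
qed

lemma first_disjoint_disjoint: "Y \<inter> first_disjoint n k Y = {}"
  by (auto simp: first_disjoint_def first_elems_def)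

lemma first_disjoint_lex_le:
  assumes "X \<in> nsets {2..n} k" "Y \<inter> X = {}"
  shows "lex_le (first_disjoint n k Y) X"
  unfolding first_disjoint_def using assms by (intro first_elems_lex_le) (auto simp: nsets_def)

text \<open>A prescribed prefix of the least disjoint set amounts to the complementary prefix of
  \<open>Y\<close>; hence the sets \<open>Y\<close> sent into a node form a node again.\<close>

lemma first_disjoint_prefix_iff:
  assumes "card p < k \<or> (card p = k \<and> i \<in> p)" "Y \<subseteq> {2..n}" "p \<subseteq> {2..i}" "i \<le> n"
  shows "first_disjoint n k Y \<inter> {..i} = p \<longleftrightarrow> Y \<inter> {..i} = {2..i} - p"
proof -
  have "first_disjoint n k Y \<inter> {..i} = p \<longleftrightarrow> ({2..n} - Y) \<inter> {..i} = p"
    unfolding first_disjoint_def using assms by (intro first_elems_prefix_iff) auto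
  also have "({2..n} - Y) \<inter> {..i} = {2..i} - Y \<inter> {..i}" using assms by auto
  also have "{2..i} - Y \<inter> {..i} = p \<longleftrightarrow> Y \<inter> {..i} = {2..i} - p" using assms by fastforce
  finally show ?thesis .
qed

text \<open>
  If \<open>\<B>\<close> is an initial segment, then \<open>Y\<close> meets all members of \<open>\<B>\<close> iff
  \<open>first_disjoint n k Y \<notin> \<B>\<close>. Hence, up to the constant \<open>n - 1 choose (k - 1)\<close>, the surplus of
  \<open>\<B>\<close> is the size of \<open>\<B>\<close> plus that of the largest family of \<open>(k - 1)\<close>-sets cross-intersecting it.
\<close>

definition surplus :: "nat \<Rightarrow> nat \<Rightarrow> nat set set \<Rightarrow> int" where
  "surplus n k \<D> = int (card \<D>)
     - int (card {Y \<in> nsets {2..n} (k - 1). first_disjoint n k Y \<in> \<D>})"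

lemma surplus_empty [simp]: "surplus n k {} = 0"
  by (simp add: surplus_def)

lemma finite_nsets_interval [simp]: "finite (nsets {a..b::nat} r)"
  by (simp add: finite_imp_finite_nsets)

lemma surplus_Un:
  assumes "\<D> \<subseteq> nsets {2..n} k" "\<E> \<subseteq> nsets {2..n} k" "\<D> \<inter> \<E> = {}"
  shows "surplus n k (\<D> \<union> \<E>) = surplus n k \<D> + surplus n k \<E>"
proof -
  let ?Y = "\<lambda>\<D>. {Y \<in> nsets {2..n} (k - 1). first_disjoint n k Y \<in> \<D>}"
  have "card (\<D> \<union> \<E>) = card \<D> + card \<E>"
    using assms finite_subset[OF _ finite_nsets_interval] by (intro card_Un_disjoint) auto
  moreover have "card (?Y \<D> \<union> ?Y \<E>) = card (?Y \<D>) + card (?Y \<E>)"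
    using assms by (intro card_Un_disjoint) auto
  moreover have "?Y \<D> \<union> ?Y \<E> = ?Y (\<D> \<union> \<E>)" by auto
  ultimately show ?thesis by (simp add: surplus_def)
qed

section \<open>Surplus of all sets with a prescribed trace on an initial interval\<close>

definition node :: "nat \<Rightarrow> nat \<Rightarrow> nat set \<Rightarrow> nat \<Rightarrow> nat set set" where
  "node n r p i = {X \<in> nsets {2..n} r. X \<inter> {..i} = p}"

lemma bij_betw_node:
  assumes "p \<subseteq> {2..i}" "1 \<le> i" "i \<le> n" "card p \<le> r"
  shows "bij_betw (\<lambda>X. X - p) (node n r p i) (nsets {i+1..n} (r - card p))"
proof (rule bij_betw_byWitness[where f' = "\<lambda>Z. Z \<union> p"])
  have finp: "finite p" using assms finite_subset by auto
  show "\<forall>X\<in>node n r p i. X - p \<union> p = X" by (auto simp: node_def)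
  show "\<forall>Z\<in>nsets {i+1..n} (r - card p). Z \<union> p - p = Z"
    using assms by (fastforce simp: nsets_def)
  show "(\<lambda>X. X - p) ` node n r p i \<subseteq> nsets {i+1..n} (r - card p)"
  proof clarify
    fix X assume X: "X \<in> node n r p i"
    then have "p \<subseteq> X" "X \<subseteq> {2..n}" "finite X" "card X = r" and eq: "X \<inter> {..i} = p"
      by (auto simp: node_def nsets_def)
    moreover have "x \<ge> Suc i" if "x \<in> X - p" for x using that eq by fastforce
    ultimately show "X - p \<in> nsets {i+1..n} (r - card p)"
      using finp by (auto simp: nsets_def card_Diff_subset)
  qed
  show "(\<lambda>Z. Z \<union> p) ` nsets {i+1..n} (r - card p) \<subseteq> node n r p i"
  proof clarify
    fix Z assume Z: "Z \<in> nsets {i+1..n} (r - card p)"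
    have disj: "Z \<inter> p = {}" using Z assms by (fastforce simp: nsets_def)
    have "card (Z \<union> p) = r"
      using Z finp disj assms by (subst card_Un_disjoint) (auto simp: nsets_def)
    moreover have "(Z \<union> p) \<inter> {..i} = p" using Z assms by (fastforce simp: nsets_def)
    moreover have "Z \<union> p \<subseteq> {2..n}" using Z assms by (fastforce simp: nsets_def)
    ultimately show "Z \<union> p \<in> node n r p i"
      using Z finp by (auto simp: node_def nsets_def)
  qed
qed

lemma card_node:
  assumes "p \<subseteq> {2..i}" "1 \<le> i" "i \<le> n"
  shows "card (node n r p i) = (if card p \<le> r then (n - i) choose (r - card p) else 0)"
proof (cases "card p \<le> r")
  case True
  then show ?thesis using bij_betw_same_card[OF bij_betw_node[OF assms True]] by simp
next
  case False
  have "card p \<le> r" if "X \<in> node n r p i" for X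
    using that by (auto simp: node_def nsets_def intro!: card_mono)
  then have "node n r p i = {}" using False by blast
  then show ?thesis using False by simp
qed

text \<open>The sets \<open>Y\<close> sent into the node have trace \<open>{2..i} - p\<close>, of
  size \<open>i - 1 - card p\<close>, which leaves \<open>k + card p - i\<close> elements beyond
  \<open>i\<close>. The \<open>if\<close> covers a trace larger than \<open>k - 1\<close>, where
  truncated subtraction would produce a spurious 1.\<close>

lemma surplus_node:
  assumes "n > 2 * k" "p \<subseteq> {2..i}" "1 \<le> i" "i \<le> n" "card p < k \<or> (card p = k \<and> i \<in> p)"
  shows "surplus n k (node n k p i) = int ((n - i) choose (k - card p))
           - (if i \<le> k + card p then int ((n - i) choose (k + card p - i)) else 0)"
proof -
  have finp: "finite p" using assms finite_subset by auto
  have "card p \<le> i - 1" using card_mono[OF _ assms(2)] by simp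
  moreover have "card ({2..i} - p) = (i - 1) - card p"
    using assms finp by (subst card_Diff_subset) auto
  moreover have k1: "k \<ge> 1" using assms(5) finp by (auto simp: Suc_le_eq card_gt_0_iff)
  ultimately have le: "card ({2..i} - p) \<le> k - 1 \<longleftrightarrow> i \<le> k + card p"
    and diff: "i \<le> k + card p \<Longrightarrow> (k - 1) - card ({2..i} - p) = k + card p - i"
    using assms(3) by auto
  have "{Y \<in> nsets {2..n} (k - 1). first_disjoint n k Y \<in> node n k p i}
          = node n (k - 1) ({2..i} - p) i"
  proof -
    have "first_disjoint n k Y \<in> node n k p i \<longleftrightarrow> Y \<inter> {..i} = {2..i} - p"
      if Y: "Y \<in> nsets {2..n} (k - 1)" for Y
    proof -
      have "Y \<subseteq> {2..n}" using Y by (simp add: nsets_def)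
      then have "first_disjoint n k Y \<inter> {..i} = p \<longleftrightarrow> Y \<inter> {..i} = {2..i} - p"
        using assms by (intro first_disjoint_prefix_iff) auto
      then show ?thesis
        using first_disjoint_nsets[OF assms(1) k1 Y] by (simp add: node_def)
    qed
    then show ?thesis by (auto simp: node_def)
  qed
  then show ?thesis
    unfolding surplus_def using assms le diff by (auto simp: card_node)
qed

text \<open>Beyond the middle, reflect \<open>b\<close> to \<open>N - b\<close>, which still exceeds
  \<open>a\<close> because \<open>a + b < N\<close>.\<close>

lemma binomial_strict_mono_sum:
  fixes a b N :: nat
  assumes "a < b" "a + b < N"
  shows "N choose a < N choose b"
proof (cases "2 * b \<le> N")
  case True then show ?thesis using assms binomial_strict_mono by simp
next
  case False
  then have "N choose a < N choose (N - b)" using assms by (intro binomial_strict_mono) auto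
  also have "\<dots> = N choose b" using binomial_symmetric[of b N] assms by simp
  finally show ?thesis .
qed

text \<open>The indices \<open>k - card p\<close> and \<open>k + card p - i\<close> sum to
  \<open>2 * k - i < n - i\<close>, so the binomial coefficients compare as the indices do,
  according to the sign of \<open>i - 2 * card p\<close>.\<close>

lemma surplus_node_neg:
  assumes "n > 2 * k" "p \<subseteq> {2..i}" "1 \<le> i" "i \<le> n" "card p < k \<or> (card p = k \<and> i \<in> p)"
    and "i < 2 * card p"
  shows "surplus n k (node n k p i) < 0"
proof -
  have "card p \<le> k" using assms by auto
  then have "(n - i) choose (k - card p) < (n - i) choose (k + card p - i)"
    using assms by (intro binomial_strict_mono_sum) auto
  then show ?thesis using surplus_node[OF assms(1-5)] \<open>card p \<le> k\<close> assms(6) by auto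
qed

lemma surplus_node_zero:
  assumes "n > 2 * k" "p \<subseteq> {2..i}" "1 \<le> i" "i \<le> n" "card p < k \<or> (card p = k \<and> i \<in> p)"
    and "i = 2 * card p"
  shows "surplus n k (node n k p i) = 0"
proof -
  have "card p \<le> k" using assms by auto
  then show ?thesis using surplus_node[OF assms(1-5)] assms(6) by (simp add: mult_2)
qed

lemma surplus_node_nonneg:
  assumes "n > 2 * k" "p \<subseteq> {2..i}" "1 \<le> i" "i \<le> n" "card p < k \<or> (card p = k \<and> i \<in> p)"
    and "2 * card p \<le> i"
  shows "surplus n k (node n k p i) \<ge> 0"
proof (cases "i = 2 * card p \<or> \<not> i \<le> k + card p")
  case True
  then show ?thesis using surplus_node_zero[OF assms(1-5)] surplus_node[OF assms(1-5)] by auto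
next
  case False
  then have "(n - i) choose (k + card p - i) < (n - i) choose (k - card p)"
    using assms by (intro binomial_strict_mono_sum) auto
  then show ?thesis using surplus_node[OF assms(1-5)] by auto
qed

section \<open>Half-full nodes, by regularity of the disjointness graph\<close>

lemma card_nsets_avoiding:
  fixes Z :: "nat set"
  assumes "finite Z" "X \<in> nsets Z u"
  shows "card {Y \<in> nsets Z u. Y \<inter> X = {}} = (card Z - u) choose u"
proof -
  have "{Y \<in> nsets Z u. Y \<inter> X = {}} = nsets (Z - X) u" by (auto simp: nsets_def)
  moreover have "card (Z - X) = card Z - u"
    using assms by (subst card_Diff_subset) (auto simp: nsets_def)
  ultimately show ?thesis by simp
qed

text \<open>The disjointness graph between two copies of the \<open>u\<close>-sets is regular of positive degree.\<close>

lemma card_cross_intersecting_same_size: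
  fixes Z :: "nat set"
  assumes "finite Z" "2 * u \<le> card Z" "\<U> \<subseteq> nsets Z u" "\<V> \<subseteq> nsets Z u"
    "cross_intersecting \<U> \<V>"
  shows "card \<U> + card \<V> \<le> card Z choose u"
proof -
  let ?N = "nsets Z u" and ?d = "(card Z - u) choose u"
  have finN: "finite ?N" using assms by (simp add: finite_imp_finite_nsets)
  have fin: "finite \<U>" "finite \<V>" using assms finN finite_subset by blast+
  have deg: "(\<Sum>Y\<in>?N. of_bool (Y \<inter> X = {})) = ?d" if "X \<in> ?N" for X
    using card_nsets_avoiding[OF assms(1) that] finN
    by (simp add: sum.If_cases of_bool_def Int_def)
  \<comment> \<open>Double counting of disjoint pairs: all disjoint partners of a member of
    \<open>\<U>\<close> lie outside \<open>\<V>\<close>, and each set there has \<open>?d\<close>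
    partners altogether.\<close>
  have "card \<U> * ?d = (\<Sum>X\<in>\<U>. \<Sum>Y\<in>?N. of_bool (Y \<inter> X = {}))"
    using deg assms by (simp add: subset_iff)
  also have "\<dots> = (\<Sum>X\<in>\<U>. \<Sum>Y\<in>?N - \<V>. of_bool (Y \<inter> X = {}))"
    using assms finN
    by (intro sum.cong refl sum.mono_neutral_right)
      (auto simp: cross_intersecting_def Int_commute)
  also have "\<dots> = (\<Sum>Y\<in>?N - \<V>. \<Sum>X\<in>\<U>. of_bool (X \<inter> Y = {}))"
    by (subst sum.swap) (simp add: Int_commute)
  also have "\<dots> \<le> (\<Sum>Y\<in>?N - \<V>. \<Sum>X\<in>?N. of_bool (X \<inter> Y = {}))"
    using assms finN by (intro sum_mono sum_mono2) auto
  also have "\<dots> = card (?N - \<V>) * ?d" using deg by simp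
  finally have "card \<U> \<le> card (?N - \<V>)" using assms(2) by simp
  also have "\<dots> = card ?N - card \<V>" using assms fin by (simp add: card_Diff_subset)
  finally have "card \<U> \<le> card ?N - card \<V>" .
  moreover have "card \<V> \<le> card ?N" using assms(4) by (rule card_mono[OF finN])
  ultimately show ?thesis by simp
qed

text \<open>"Above" means later in the order. With \<open>T = R \<inter> {..i}\<close> this is the
  interval from \<open>R\<close>, excluded, to \<open>T\<close>; see
  \<open>between_eq_node_above\<close>.\<close>

definition node_above :: "nat \<Rightarrow> nat \<Rightarrow> nat set \<Rightarrow> nat \<Rightarrow> nat set set" where
  "node_above n k R i = {X \<in> node n k (R \<inter> {..i}) i. lex_less R X}"

text \<open>At \<open>i = 2 * card p\<close>, the members of the node and the sets \<open>Y\<close>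
  sent into it both have \<open>u\<close> free elements beyond \<open>i\<close>. The
  \<open>Y\<close> sent above \<open>R\<close> cross-intersect the members not above
  \<open>R\<close>, so regularity bounds their number by that of the members above
  \<open>R\<close>.\<close>

lemma surplus_half_node_above:
  assumes "n > 2 * k" "R \<in> nsets {2..n} k" "1 \<le> i" "i \<le> n" "i = 2 * card (R \<inter> {..i})"
  shows "surplus n k (node_above n k R i) \<ge> 0"
proof -
  define p where "p = R \<inter> {..i}"
  have R: "R \<subseteq> {2..n}" "finite R" "card R = k" using assms by (auto simp: nsets_def)
  have p: "p \<subseteq> {2..i}" "finite p" "card p \<le> k" "p \<subseteq> R"
    using R card_mono[of R p] by (auto simp: p_def)
  show ?thesis
  \<comment> \<open>A trace of full size determines the set, so nothing lies above \<open>R\<close>.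
    Otherwise \<open>card p < k\<close>, as \<open>first_disjoint_prefix_iff\<close>
    requires.\<close>
  proof (cases "card p = k")
    case True
    have "X = R" if "X \<in> node n k p i" for X
    proof -
      have "p \<subseteq> X" "finite X" "card X = k" using that by (auto simp: node_def nsets_def)
      then show ?thesis using True p R by (metis card_subset_eq)
    qed
    then have "node_above n k R i = {}" by (auto simp: node_above_def p_def[symmetric])
    then show ?thesis by simp
  next
    case False
    define u where "u = k - card p"
    let ?N = "node n k p i"
    let ?D = "node_above n k R i"
    let ?Y = "{Y \<in> nsets {2..n} (k - 1). first_disjoint n k Y \<in> ?D}"
    let ?q = "{2..i} - p"
    have D: "?D \<subseteq> ?N" by (auto simp: node_above_def p_def)
    have finN: "finite ?N" by (simp add: node_def)
    have Yq: "?Y \<subseteq> node n (k - 1) ?q i"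
    proof
      fix Y assume Y: "Y \<in> ?Y"
      then have "first_disjoint n k Y \<inter> {..i} = p" using D by (auto simp: node_def)
      then have "Y \<inter> {..i} = ?q"
        using Y False p assms by (subst first_disjoint_prefix_iff[symmetric, where k = k])
          (auto simp: nsets_def)
      then show "Y \<in> node n (k - 1) ?q i" using Y by (simp add: node_def)
    qed
    have i2: "i = 2 * card p" using assms p_def by simp
    \<comment> \<open>The element 1 is in neither trace, so the complement has one element less than
      \<open>p\<close>. This matches the sizes \<open>k - 1\<close> and \<open>k\<close> and leaves
      \<open>u\<close> free elements on both sides.\<close>
    have cq: "card ?q = card p - 1" using p i2 by (simp add: card_Diff_subset)
    have cp: "card p \<ge> 1" using i2 assms by simp
    have uq: "k - 1 - card ?q = u" using cq cp False p by (simp add: u_def)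
    have bN: "bij_betw (\<lambda>X. X - p) ?N (nsets {i+1..n} u)"
      unfolding u_def using p assms by (intro bij_betw_node) auto
    have bY: "bij_betw (\<lambda>X. X - ?q) (node n (k - 1) ?q i) (nsets {i+1..n} u)"
      unfolding uq[symmetric] using cq p assms by (intro bij_betw_node) auto
    \<comment> \<open>If \<open>Y\<close> were disjoint from \<open>X\<close>, then
      \<open>first_disjoint n k Y\<close> would be at most \<open>X\<close>, and being after
      \<open>R\<close> it would put \<open>X\<close> above \<open>R\<close> too.\<close>
    have cross: "cross_intersecting ((\<lambda>X. X - ?q) ` ?Y) ((\<lambda>X. X - p) ` (?N - ?D))"
      unfolding cross_intersecting_def
    proof clarify
      fix Y X assume Y: "Y \<in> nsets {2..n} (k - 1)" "first_disjoint n k Y \<in> ?D"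
        and X: "X \<in> ?N" "X \<notin> ?D" and disj: "(Y - ?q) \<inter> (X - p) = {}"
      have "Y \<inter> {..i} = ?q" using Yq Y by (auto simp: node_def)
      moreover have "X \<inter> {..i} = p" using X by (auto simp: node_def)
      ultimately have "Y \<inter> X = {}" using disj by blast
      moreover have Xn: "X \<in> nsets {2..n} k" using X by (auto simp: node_def)
      ultimately have "lex_le (first_disjoint n k Y) X" by (intro first_disjoint_lex_le)
      moreover have "lex_less R (first_disjoint n k Y)" using Y by (auto simp: node_above_def)
      moreover have "finite (first_disjoint n k Y)" by (simp add: first_disjoint_def first_elems_def)
      ultimately have "lex_less R X"
        using lex_less_le_trans R Xn finite_nsets_elem by metis
      then show False using X by (simp add: node_above_def p_def)
    qed
    have "card ((\<lambda>X. X - ?q) ` ?Y) + card ((\<lambda>X. X - p) ` (?N - ?D))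
            \<le> card {i+1..n} choose u"
    proof (rule card_cross_intersecting_same_size[OF _ _ _ _ cross])
      show "2 * u \<le> card {i+1..n}" using i2 assms(1) by (simp add: u_def)
      show "(\<lambda>X. X - ?q) ` ?Y \<subseteq> nsets {i+1..n} u"
        using bij_betw_imp_surj_on[OF bY] Yq by blast
      show "(\<lambda>X. X - p) ` (?N - ?D) \<subseteq> nsets {i+1..n} u"
        using bij_betw_imp_surj_on[OF bN] by blast
    qed simp
    moreover have "card ((\<lambda>X. X - ?q) ` ?Y) = card ?Y"
      by (intro card_image inj_on_subset[OF bij_betw_imp_inj_on[OF bY] Yq])
    moreover have "card ((\<lambda>X. X - p) ` (?N - ?D)) = card (?N - ?D)"
      by (intro card_image inj_on_subset[OF bij_betw_imp_inj_on[OF bN]] Diff_subset)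
    moreover have "card ?N = card {i+1..n} choose u" using bij_betw_same_card[OF bN] by simp
    moreover have "card (?N - ?D) = card ?N - card ?D" "card ?D \<le> card ?N"
      using D finN by (auto intro: card_Diff_subset card_mono finite_subset)
    ultimately have "card ?Y \<le> card ?D" by linarith
    then show ?thesis by (simp add: surplus_def)
  qed
qed

lemma node_above_subset: "node_above n k R i \<subseteq> nsets {2..n} k"
  by (auto simp: node_above_def node_def)

text \<open>Split by whether \<open>X\<close> agrees with \<open>R\<close> at \<open>Suc i\<close>.
  Dropping \<open>Suc i \<in> R\<close> puts \<open>X\<close> after \<open>R\<close> whatever
  follows; gaining \<open>Suc i \<notin> R\<close> puts it before \<open>R\<close>.\<close>

lemma surplus_node_above_step:
  assumes "R \<subseteq> {2..n}"
  shows "surplus n k (node_above n k R i) = surplus n k (node_above n k R (Suc i))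
           + (if Suc i \<in> R then surplus n k (node n k (R \<inter> {..i}) (Suc i)) else 0)"
proof -
  have finR: "finite R" using assms finite_subset by auto
  have Suc_Int: "A \<inter> {..Suc i} = (if Suc i \<in> A then insert (Suc i) (A \<inter> {..i}) else A \<inter> {..i})"
    for A :: "nat set" by (auto simp: le_Suc_eq)
  let ?E = "if Suc i \<in> R then node n k (R \<inter> {..i}) (Suc i) else {}"
  have "node_above n k R i = node_above n k R (Suc i) \<union> ?E"
  proof (intro equalityI subsetI)
    fix X assume X: "X \<in> node_above n k R i"
    then have Xn: "X \<in> nsets {2..n} k" "finite X" and lt: "lex_less R X"
      and eq: "X \<inter> {..i} = R \<inter> {..i}"
      by (auto simp: node_above_def node_def nsets_def)
    have "\<not> lex_less X R" using lt lex_less_asym Xn finR by blast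
    then have "Suc i \<in> R" if "Suc i \<in> X"
      using that lex_lessI[of X R "Suc i"] Xn finR eq by (auto simp: lessThan_Suc_atMost)
    then show "X \<in> node_above n k R (Suc i) \<union> ?E"
      using Xn lt eq by (auto simp: node_above_def node_def Suc_Int)
  next
    fix X assume X: "X \<in> node_above n k R (Suc i) \<union> ?E"
    have sub: "A \<inter> {..i} = A \<inter> {..Suc i} \<inter> {..i}" for A :: "nat set" by auto
    show "X \<in> node_above n k R i"
    proof (cases "X \<in> node_above n k R (Suc i)")
      case True
      then show ?thesis using sub[of X] sub[of R] by (auto simp: node_above_def node_def)
    next
      case False
      then have S: "Suc i \<in> R" and X: "X \<in> node n k (R \<inter> {..i}) (Suc i)"
        using X by (auto split: if_splits)
      then have eq: "X \<inter> {..Suc i} = R \<inter> {..i}" and Xn: "X \<in> nsets {2..n} k"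
        by (auto simp: node_def)
      have eq': "X \<inter> {..i} = R \<inter> {..i}" using sub[of X] eq by auto
      have "Suc i \<notin> X \<inter> {..Suc i}" unfolding eq by simp
      then have "Suc i \<notin> X" by simp
      then have "lex_less R X" using S finR eq' finite_nsets_elem[OF Xn]
        by (intro lex_lessI[of _ _ "Suc i"]) (auto simp: lessThan_Suc_atMost)
      then show ?thesis using Xn eq' by (simp add: node_above_def node_def)
    qed
  qed
  moreover have "node_above n k R (Suc i) \<inter> ?E = {}"
  proof -
    have "Suc i \<in> R \<inter> {..Suc i} \<and> Suc i \<notin> R \<inter> {..i}" if "Suc i \<in> R" using that by simp
    then have "X \<inter> {..Suc i} \<noteq> R \<inter> {..i}"
      if "Suc i \<in> R" "X \<inter> {..Suc i} = R \<inter> {..Suc i}" for X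
      using that by metis
    then show ?thesis by (auto simp: node_above_def node_def)
  qed
  moreover have "?E \<subseteq> nsets {2..n} k" by (auto simp: node_def)
  ultimately show ?thesis using surplus_Un[OF node_above_subset[of n k R "Suc i"], of ?E] by auto
qed

section \<open>Resistant sets\<close>

lemma lex_family_subset_eq:
  "X \<subseteq> {2..n} \<Longrightarrow> lex_family n X r = {A \<in> nsets {2..n} r. lex_le A X}"
  by (simp add: lex_family_def Int_absorb2)

lemma Int_atMost_eq:
  fixes A B :: "nat set"
  assumes "A \<inter> {..<d} = B \<inter> {..<d}" "i < d"
  shows "A \<inter> {..i} = B \<inter> {..i}"
proof -
  have "{..i} = {..<d} \<inter> {..i}" using assms(2) by auto
  then show ?thesis using assms(1) by (metis Int_assoc)
qed

lemma Int_lessThan_eq: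
  fixes A B :: "nat set"
  assumes "A \<inter> {..<d} = B \<inter> {..<d}" "i \<le> d"
  shows "A \<inter> {..<i} = B \<inter> {..<i}"
proof -
  have "{..<i} = {..<d} \<inter> {..<i}" using assms(2) by auto
  then show ?thesis using assms(1) by (metis Int_assoc)
qed

lemma Int_atMost_insert:
  fixes A :: "nat set"
  shows "d \<in> A \<Longrightarrow> A \<inter> {..d} = insert d (A \<inter> {..<d})"
  by auto

lemma Int_atMost_lessThan:
  fixes A :: "nat set"
  shows "d \<notin> A \<Longrightarrow> A \<inter> {..d} = A \<inter> {..<d}"
  by (auto simp: order_le_less)

lemma lex_le_lessThan_cases:
  assumes "lex_le A B" "finite A" "finite B"
  obtains "A = B" | d where "d \<in> A" "d \<notin> B" "A \<inter> {..<d} = B \<inter> {..<d}"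
  using assms lex_lessE by (metis lex_le_def)

text \<open>The pair conditions in terms of \<open>T\<close> alone. Below \<open>Max T\<close> the
  set \<open>S\<close> is the complement of \<open>T\<close>; at \<open>Max T\<close> the shared
  element shifts the inequality by 2. Containing \<open>{2, 3, 4}\<close> is the condition at 4, and
  \<open>card S \<le> k\<close> follows from the rest.\<close>

definition resistant_set :: "nat \<Rightarrow> nat \<Rightarrow> nat set \<Rightarrow> bool" where
  "resistant_set n k T \<longleftrightarrow> T \<subseteq> {2..n} \<and> {2, 3, 4} \<subseteq> T \<and> card T \<le> k \<and>
     (T = {2, 3, 4} \<or>
      Max T + 2 < 2 * card T \<and> (\<forall>i. 4 \<le> i \<and> i < Max T \<longrightarrow> i < 2 * card (T \<inter> {..i})))"

lemma resistant_setD: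
  assumes "resistant_set n k T"
  shows "T \<subseteq> {2..n}" "{2, 3, 4} \<subseteq> T" "card T \<le> k" "finite T"
    "Max T \<in> T" "4 \<le> Max T" "Max T \<le> n" "T \<inter> {..Max T} = T" "T \<subseteq> {2..Max T}"
proof -
  show T: "T \<subseteq> {2..n}" "{2, 3, 4} \<subseteq> T" "card T \<le> k"
    using assms by (auto simp: resistant_set_def)
  show fin: "finite T" using T finite_subset by blast
  show M: "Max T \<in> T" using fin T by (intro Max_in) auto
  show "4 \<le> Max T" using fin T by (intro Max_ge) auto
  show "Max T \<le> n" using M T by auto
  show "T \<inter> {..Max T} = T" "T \<subseteq> {2..Max T}" using T fin by auto
qed

text \<open>At \<open>Max T\<close> this is weaker than the defining inequality, so that it covers
  the exceptional set \<open>{2, 3, 4}\<close> as well.\<close>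

lemma resistant_set_prefix_gt:
  assumes "resistant_set n k T" "4 \<le> i" "i \<le> Max T"
  shows "i < 2 * card (T \<inter> {..i})"
proof (cases "T = {2, 3, 4}")
  case True
  then have "i = 4" using assms by simp
  moreover have "T \<inter> {..4} = T" using True by auto
  ultimately show ?thesis using True by simp
next
  case False
  then show ?thesis
    using assms resistant_setD(8)[OF assms(1)] by (cases "i = Max T") (auto simp: resistant_set_def)
qed

lemma resistant_set_prefix:
  assumes "R \<subseteq> {2..n}" "{2, 3, 4} \<subseteq> R" "card R \<le> k" "c \<in> R" "4 \<le> c"
    "\<And>i. 4 \<le> i \<Longrightarrow> i < c \<Longrightarrow> i < 2 * card (R \<inter> {..i})" "c + 2 < 2 * card (R \<inter> {..c})"
  shows "resistant_set n k (R \<inter> {..c})"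
proof -
  have fin: "finite R" using assms finite_subset by blast
  have "Max (R \<inter> {..c}) = c" using fin assms by (intro Max_eqI) auto
  moreover have "R \<inter> {..c} \<inter> {..i} = R \<inter> {..i}" if "i < c" for i using that by auto
  moreover have "card (R \<inter> {..c}) \<le> k" using assms fin card_mono[of R "R \<inter> {..c}"] by auto
  moreover have "{2, 3, 4} \<subseteq> R \<inter> {..c}" using assms by auto
  ultimately show ?thesis using assms by (auto simp: resistant_set_def)
qed

text \<open>
  Where \<open>R\<close> branches off to the left of a resistant set \<open>T\<close>, the prefix of \<open>T\<close> is still balanced
  towards elements, which is exactly what makes the prefix of \<open>R\<close> resistant.
\<close>

lemma resistant_set_branch:
  assumes "resistant_set n k T" "R \<subseteq> {2..n}" "{2, 3, 4} \<subseteq> R" "card R \<le> k"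
    "d \<in> R" "d \<notin> T" "R \<inter> {..<d} = T \<inter> {..<d}" "d < Max T"
  shows "resistant_set n k (R \<inter> {..d})"
proof (rule resistant_set_prefix[OF assms(2-5)])
  have "d \<noteq> 2" "d \<noteq> 3" "d \<noteq> 4" "d \<ge> 2" using assms resistant_setD(2)[OF assms(1)] by auto
  then show d: "4 \<le> d" by simp
  show "i < 2 * card (R \<inter> {..i})" if "4 \<le> i" "i < d" for i
    using resistant_set_prefix_gt[OF assms(1) that(1)] Int_atMost_eq[OF assms(7) that(2)] that assms(8)
    by simp
  have fin: "finite R" using assms(2) finite_subset by blast
  have "d < 2 * card (T \<inter> {..d})" using resistant_set_prefix_gt[OF assms(1) d] assms(8) by simp
  also have "T \<inter> {..d} = R \<inter> {..<d}" using assms by (simp add: Int_atMost_lessThan)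
  finally show "d + 2 < 2 * card (R \<inter> {..d})" using fin assms(5) by (simp add: Int_atMost_insert)
qed

lemma lex_le_contains:
  assumes "lex_le R T" "{2, 3, 4} \<subseteq> T" "R \<subseteq> {2..n}" "finite T"
  shows "{2, 3, 4} \<subseteq> R"
proof -
  have "finite R" using assms finite_subset by blast
  from assms(1) this assms(4) show ?thesis
  proof (cases rule: lex_le_lessThan_cases)
    case 1 then show ?thesis using assms by simp
  next
    case (2 d)
    have "d \<noteq> 2" "d \<noteq> 3" "d \<noteq> 4" "d \<ge> 2" using 2 assms by auto
    then have "{2, 3, 4} \<subseteq> T \<inter> {..<d}" using assms by auto
    then show ?thesis using 2 by auto
  qed
qed

text \<open>A set after \<open>R\<close> first loses some element \<open>e\<close> of
  \<open>R\<close>. If \<open>e \<le> j\<close>, it loses an element of \<open>T\<close> and comes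
  after \<open>T\<close>; so it must keep the whole prefix.\<close>

lemma between_eq_node_above:
  assumes "finite R" "T = R \<inter> {..j}"
  shows "{X \<in> nsets {2..n} k. lex_less R X \<and> lex_le X T} = node_above n k R j"
proof -
  have finT: "finite T" using assms by auto
  have "lex_le X T \<longleftrightarrow> X \<inter> {..j} = T" if X: "finite X" "lex_less R X" for X
  proof
    assume "X \<inter> {..j} = T"
    then show "lex_le X T" using X by (intro superset_lex_le) auto
  next
    assume le: "lex_le X T"
    obtain e where e: "e \<in> R" "e \<notin> X" "R \<inter> {..<e} = X \<inter> {..<e}"
      using X assms lex_lessE by metis
    have "\<not> e \<le> j"
    proof
      assume "e \<le> j"
      then have "T \<inter> {..<e} = R \<inter> {..<e}" unfolding assms(2) by auto
      then have "T \<inter> {..<e} = X \<inter> {..<e}" using e(3) by simp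
      then have "lex_less T X" using e \<open>e \<le> j\<close> assms X finT by (intro lex_lessI[of _ _ e]) auto
      then show False using le X finT lex_le_iff_not_less by auto
    qed
    then show "X \<inter> {..j} = T" using Int_atMost_eq[OF e(3)] assms by simp
  qed
  then show ?thesis
    unfolding node_above_def node_def assms(2)[symmetric] using finite_nsets_elem by blast
qed

text \<open>
  The walk \<open>2 * card (R \<inter> {..i}) - i\<close> is positive at \<open>i = 4\<close> and negative at \<open>i = n\<close>, so it
  vanishes somewhere. The part of that node above \<open>R\<close> has nonnegative surplus, and minimality of
  \<open>T\<close> keeps the surplus of all nodes passed on the way up to \<open>T\<close> nonnegative.
\<close>

lemma surplus_up_to_resistant_nonneg:
  assumes n: "n > 2 * k" and k: "k \<ge> 3" and R: "R \<in> nsets {2..n} k" and T: "resistant_set n k T"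
    and le: "lex_le R T"
    and least: "\<And>V. resistant_set n k V \<Longrightarrow> lex_le R V \<Longrightarrow> \<not> lex_less V T"
  shows "surplus n k {X \<in> nsets {2..n} k. lex_less R X \<and> lex_le X T} \<ge> 0"
proof -
  note TD = resistant_setD[OF T]
  have R': "R \<subseteq> {2..n}" "finite R" "card R = k" using R by (auto simp: nsets_def)
  have R234: "{2, 3, 4} \<subseteq> R" using lex_le_contains[OF le TD(2) R'(1) TD(4)] .
  define j where "j = Max T"
  \<comment> \<open>Otherwise \<open>R\<close> leaves \<open>T\<close> at some \<open>d < j\<close>,
    and by \<open>resistant_set_branch\<close> its prefix up to \<open>d\<close> is a resistant set
    from \<open>R\<close> on and before \<open>T\<close>, against \<open>least\<close>.\<close>
  have TR: "T = R \<inter> {..j}"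
    using le R'(2) TD(4)
  proof (cases rule: lex_le_lessThan_cases)
    case 1 then show ?thesis using TD(8) by (simp add: j_def)
  next
    case (2 d)
    consider "d < j" | "d > j" using 2 TD(5) by (metis j_def linorder_neqE_nat)
    then show ?thesis
    proof cases
      case 1
      have "resistant_set n k (R \<inter> {..d})"
        using 2 1 R' R234 by (intro resistant_set_branch[OF T]) (auto simp: j_def)
      moreover have "lex_le R (R \<inter> {..d})" using R' by (intro superset_lex_le) auto
      moreover have "lex_less (R \<inter> {..d}) T"
        using 2 R' TD by (intro lex_lessI[of _ _ d]) auto
      ultimately show ?thesis using least by blast
    next
      case 2
      then show ?thesis
        using Int_atMost_eq[OF \<open>R \<inter> {..<d} = T \<inter> {..<d}\<close>] TD(8) by (simp add: j_def)
    qed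
  qed
  have j4: "4 \<le> j" using TD by (simp add: j_def)
  \<comment> \<open>The first \<open>i \<ge> 4\<close> at which the walk is no longer positive;
    \<open>i = n\<close> is such a place because \<open>n > 2 * k\<close>.\<close>
  define i0 where "i0 = (LEAST i. 4 \<le> i \<and> 2 * card (R \<inter> {..i}) \<le> i)"
  have "R \<inter> {..n} = R" using R' by auto
  then have ex: "4 \<le> n \<and> 2 * card (R \<inter> {..n}) \<le> n" using R' n k by simp
  have i0: "4 \<le> i0 \<and> 2 * card (R \<inter> {..i0}) \<le> i0" unfolding i0_def by (rule LeastI) (rule ex)
  have i0n: "i0 \<le> n" unfolding i0_def by (rule Least_le) (rule ex)
  have before: "i < 2 * card (R \<inter> {..i})" if "4 \<le> i" "i < i0" for i
    using not_less_Least[of i "\<lambda>i. 4 \<le> i \<and> 2 * card (R \<inter> {..i}) \<le> i"] that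
    by (auto simp: i0_def)
  have "j < i0"
  proof (rule ccontr)
    assume "\<not> j < i0"
    then have "T \<inter> {..i0} = R \<inter> {..i0}" unfolding TR by auto
    then show False
      using resistant_set_prefix_gt[OF T, of i0] i0 \<open>\<not> j < i0\<close> by (simp add: j_def)
  qed
  have mono: "card (R \<inter> {..a}) \<le> card (R \<inter> {..b})" if "a \<le> b" for a b
    using that R' by (intro card_mono) auto
  \<comment> \<open>Just before \<open>i0\<close>, which is still at least 4, the walk is positive.
    The count cannot drop in one step, so only equality is left.\<close>
  have half: "i0 = 2 * card (R \<inter> {..i0})"
    using before[of "i0 - 1"] mono[of "i0 - 1" i0] i0 \<open>j < i0\<close> j4 by linarith
  have "surplus n k (node_above n k R i0) \<ge> 0"
    using half i0 i0n by (intro surplus_half_node_above n R) auto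
  with less_imp_le[OF \<open>j < i0\<close>] have "surplus n k (node_above n k R j) \<ge> 0"
  proof (induction rule: inc_induct)
    case base then show ?case .
  next
    case (step i)
    have "surplus n k (node n k (R \<inter> {..i}) (Suc i)) \<ge> 0" if c: "Suc i \<in> R"
    proof -
      have eq: "card (R \<inter> {..Suc i}) = Suc (card (R \<inter> {..i}))"
        using c R' by (simp add: Int_atMost_insert lessThan_Suc_atMost)
      \<comment> \<open>A larger count would make \<open>R \<inter> {..Suc i}\<close> resistant, and
        it precedes \<open>T\<close>, against \<open>least\<close>. At \<open>i0\<close> the bound
        comes from \<open>half\<close>.\<close>
      have "2 * card (R \<inter> {..i}) \<le> Suc i"
      proof (cases "Suc i = i0")
        case True then show ?thesis using half mono[of i i0] by simp
      next
        case False
        have "lex_less (R \<inter> {..Suc i}) T"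
        proof -
          have "lex_le (R \<inter> {..Suc i}) T" using TR R' step by (intro superset_lex_le) auto
          moreover have "R \<inter> {..Suc i} \<noteq> T"
          proof
            assume "R \<inter> {..Suc i} = T"
            then have "Suc i \<in> T" using c by auto
            then show False using TR step by auto
          qed
          ultimately show ?thesis by (simp add: lex_le_def)
        qed
        moreover have "lex_le R (R \<inter> {..Suc i})" using R' by (intro superset_lex_le) auto
        ultimately have "\<not> resistant_set n k (R \<inter> {..Suc i})" using least by blast
        then have "\<not> Suc i + 2 < 2 * card (R \<inter> {..Suc i})"
          using resistant_set_prefix[OF R'(1) R234 _ c] before R' j4 step False by fastforce
        then show ?thesis using eq by simp
      qed
      moreover have "card (R \<inter> {..i}) < k" using eq mono[of "Suc i" n] \<open>R \<inter> {..n} = R\<close> R' by (cases "Suc i \<le> n") (use c in auto)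
      ultimately show ?thesis
        using R' step i0n by (intro surplus_node_nonneg n) auto
    qed
    then show ?case using surplus_node_above_step[OF R'(1), of k i] step.IH step.prems by auto
  qed
  then show ?thesis using between_eq_node_above[OF R'(2) TR] by simp
qed

section \<open>Negative surplus between consecutive resistant sets\<close>

lemma surplus_resistant_node_neg:
  assumes "n > 2 * k" "resistant_set n k T"
  shows "surplus n k (node n k T (Max T)) < 0"
  using resistant_setD[OF assms(2)] resistant_set_prefix_gt[OF assms(2), of "Max T"] assms(1)
  by (intro surplus_node_neg) auto

text \<open>Filling a gap of \<open>T\<close> and cutting there is a branching to the left, and the
  loss of \<open>Max T\<close> pays for the new element. Hence a resistant set with no resistant set
  before it has no gaps.\<close>

lemma resistant_set_fill_gap:
  assumes "resistant_set n k T" "i \<notin> T" "4 < i" "i < Max T"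
  shows "resistant_set n k (insert i (T \<inter> {..<i}))" "lex_less (insert i (T \<inter> {..<i})) T"
proof -
  let ?V = "insert i (T \<inter> {..<i})"
  note TD = resistant_setD[OF assms(1)]
  have "Max T \<notin> T \<inter> {..<i}" using assms(4) by simp
  then have "T \<inter> {..<i} \<subset> T" using TD(5) by blast
  then have "card (T \<inter> {..<i}) < card T" by (rule psubset_card_mono[OF TD(4)])
  then have "card ?V \<le> k" using TD(3,4) by simp
  moreover have "?V \<subseteq> {2..n}" using TD(1,7) assms(3,4) by auto
  moreover have "{2, 3, 4} \<subseteq> ?V" using TD(2) assms(3) by auto
  ultimately have "resistant_set n k (?V \<inter> {..i})"
    using assms by (intro resistant_set_branch[OF assms(1)]) auto
  moreover have "?V \<inter> {..i} = ?V" by auto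
  ultimately show "resistant_set n k ?V" by simp
  show "lex_less ?V T" using TD(4) assms(2) by (intro lex_lessI[of _ _ i]) auto
qed

text \<open>Without gaps in \<open>T\<close>, a set up to \<open>T\<close> cannot branch off before
  \<open>Max T\<close>, so the segment is the single node of \<open>T\<close>.\<close>

lemma surplus_first_resistant_neg:
  assumes n: "n > 2 * k" and T: "resistant_set n k T"
    and least: "\<And>V. resistant_set n k V \<Longrightarrow> \<not> lex_less V T"
  shows "surplus n k {X \<in> nsets {2..n} k. lex_le X T} < 0"
proof -
  note TD = resistant_setD[OF T]
  have "lex_le X T \<longleftrightarrow> X \<inter> {..Max T} = T" if X: "X \<in> nsets {2..n} k" for X
  proof
    have fin: "finite X" and sub: "X \<subseteq> {2..n}" using X by (auto simp: nsets_def)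
    assume "lex_le X T"
    from this fin TD(4) show "X \<inter> {..Max T} = T"
    proof (cases rule: lex_le_lessThan_cases)
      case 1 then show ?thesis using TD by simp
    next
      case (2 d)
      have "d \<noteq> 2" "d \<noteq> 3" "d \<noteq> 4" "d \<ge> 2" using 2 TD(2) sub by auto
      then have "\<not> d < Max T" using resistant_set_fill_gap[OF T, of d] least 2 by auto
      then have "Max T < d" using 2 TD(5) by (metis linorder_neqE_nat)
      then show ?thesis using Int_atMost_eq[OF 2(3)] TD by simp
    qed
  next
    assume "X \<inter> {..Max T} = T"
    then show "lex_le X T" using finite_nsets_elem[OF X] by (intro superset_lex_le) auto
  qed
  then have "{X \<in> nsets {2..n} k. lex_le X T} = node n k T (Max T)" by (auto simp: node_def)
  then show ?thesis using surplus_resistant_node_neg[OF n T] by simp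
qed

text \<open>If \<open>U\<close> leaves \<open>T\<close> before \<open>Max T\<close>, it ends there
  and the interval is the node of \<open>T\<close>. Otherwise \<open>T\<close> is a prefix of
  \<open>U\<close>, and descending from the last element of \<open>U\<close> adds one node of
  negative surplus, then only nodes of surplus 0.\<close>

lemma surplus_between_resistant_neg:
  assumes n: "n > 2 * k" and U: "resistant_set n k U" and T: "resistant_set n k T"
    and lt: "lex_less U T"
    and consec: "\<And>V. resistant_set n k V \<Longrightarrow> lex_less U V \<Longrightarrow> \<not> lex_less V T"
  shows "surplus n k {X \<in> nsets {2..n} k. lex_less U X \<and> lex_le X T} < 0"
proof -
  note TD = resistant_setD[OF T] and UD = resistant_setD[OF U]
  obtain d where d: "d \<in> U" "d \<notin> T" "U \<inter> {..<d} = T \<inter> {..<d}"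
    using lex_lessE[OF lt UD(4) TD(4)] .
  have "d \<noteq> 2" "d \<noteq> 3" "d \<noteq> 4" "d \<ge> 2" using d TD(2) UD(1) by auto
  then have d4: "4 < d" by simp
  consider "d < Max T" | "Max T < d" using d TD(5) by (metis linorder_neqE_nat)
  then show ?thesis
  proof cases
    case 1
    have "resistant_set n k (U \<inter> {..d})"
      using 1 d UD by (intro resistant_set_branch[OF T]) auto
    moreover have "lex_less (U \<inter> {..d}) T" using d UD TD by (intro lex_lessI[of _ _ d]) auto
    moreover have "lex_le U (U \<inter> {..d})" using UD by (intro superset_lex_le) auto
    ultimately have Ud: "U \<inter> {..d} = U" using consec by (metis lex_le_def)
    have gap: "\<not> (d < i \<and> i < Max T)" if "i \<notin> T" for i
    proof
      assume i: "d < i \<and> i < Max T"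
      have "lex_less U (insert i (T \<inter> {..<i}))"
        using d i UD TD by (intro lex_lessI[of _ _ d]) auto
      then show False using resistant_set_fill_gap[OF T that] consec i d4 by auto
    qed
    \<comment> \<open>A set of the interval cannot leave \<open>T\<close> before \<open>d\<close>,
      as it would precede \<open>U\<close>; nor at \<open>d\<close>, as it would extend
      \<open>U\<close>; nor between \<open>d\<close> and \<open>Max T\<close>, by
      \<open>gap\<close>.\<close>
    have "lex_less U X \<and> lex_le X T \<longleftrightarrow> X \<inter> {..Max T} = T" if X: "X \<in> nsets {2..n} k" for X
    proof
      have fin: "finite X" using finite_nsets_elem[OF X] .
      assume X': "lex_less U X \<and> lex_le X T"
      then have "lex_le X T" and notless: "\<not> lex_le X U" using fin UD(4) lex_le_iff_not_less by auto
      from this(1) fin TD(4) show "X \<inter> {..Max T} = T"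
      proof (cases rule: lex_le_lessThan_cases)
        case 1 then show ?thesis using TD by simp
      next
        case (2 e)
        have "\<not> e < d"
        proof
          assume "e < d"
          then have "X \<inter> {..<e} = U \<inter> {..<e}" using Int_lessThan_eq[OF d(3), of e] 2(3) by simp
          moreover have "e \<notin> U" using d(3) 2 \<open>e < d\<close> by (metis IntD1 IntI lessThan_iff)
          ultimately have "lex_less X U" using fin UD 2 by (intro lex_lessI[of _ _ e]) auto
          then show False using notless by (simp add: lex_le_def)
        qed
        moreover have "e \<noteq> d"
        proof
          assume "e = d"
          then have "X \<inter> {..d} = U \<inter> {..d}" using 2 d by (simp add: Int_atMost_insert)
          then have "lex_le X U" using Ud fin by (intro superset_lex_le) auto
          then show False using notless by simp
        qed
        ultimately have "Max T < e" using gap[OF 2(2)] 2 TD(5) by (metis linorder_neqE_nat)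
        then show ?thesis using Int_atMost_eq[OF 2(3)] TD by simp
      qed
    next
      assume eq: "X \<inter> {..Max T} = T"
      have fin: "finite X" using finite_nsets_elem[OF X] .
      have "lex_le X T" using eq fin by (intro superset_lex_le) auto
      moreover have "d \<notin> X" using eq 1 d(2) by (metis IntI atMost_iff less_imp_le)
      moreover have "X \<inter> {..<d} = T \<inter> {..<d}"
      proof -
        have "X \<inter> {..<d} = X \<inter> {..Max T} \<inter> {..<d}" using 1 by auto
        then show ?thesis unfolding eq .
      qed
      ultimately show "lex_less U X \<and> lex_le X T"
        using d(1,3) lex_lessI[OF UD(4) fin, of d] by simp
    qed
    then have "{X \<in> nsets {2..n} k. lex_less U X \<and> lex_le X T} = node n k T (Max T)"
      by (auto simp: node_def)
    then show ?thesis using surplus_resistant_node_neg[OF n T] by simp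
  next
    case 2
    define t j where "t = Max T" and "j = Max U"
    have TU: "T = U \<inter> {..t}" using Int_atMost_eq[OF d(3) 2] TD(8) by (simp add: t_def)
    have t4: "4 \<le> t" using TD by (simp add: t_def)
    have "d \<le> j" using d UD(4) by (simp add: j_def)
    then have tj: "t \<le> j - 1" "4 < j" using 2 d4 by (simp_all add: t_def)
    have jU: "j \<in> U" "Suc (j - 1) = j" "j \<le> n" using UD tj by (simp_all add: j_def)
    have Uj: "U \<inter> {..j} = U" using UD by (simp add: j_def)
    have mono: "card (U \<inter> {..a}) \<le> card (U \<inter> {..b})" if "a \<le> b" for a b
      using that UD by (intro card_mono) auto
    have card_Suc: "card (U \<inter> {..Suc i}) = Suc (card (U \<inter> {..i}))" if "Suc i \<in> U" for i
      using that UD by (simp add: Int_atMost_insert lessThan_Suc_atMost)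
    have "node_above n k U j = {}"
    proof -
      have "\<not> lex_less U X" if "X \<in> nsets {2..n} k" "X \<inter> {..j} = U" for X
        using that UD(4) finite_nsets_elem superset_lex_le[of U X] lex_le_iff_not_less by blast
      then show ?thesis by (auto simp: node_above_def node_def Uj)
    qed
    \<comment> \<open>Dropping the last element \<open>j\<close> turns
      \<open>j + 2 < 2 * card U\<close> into \<open>j < 2 * card (U \<inter> {..j - 1})\<close>. The
      inequality is available since \<open>j > 4\<close> excludes the exceptional set.\<close>
    moreover have "surplus n k (node n k (U \<inter> {..j - 1}) j) < 0"
    proof -
      have "card U = Suc (card (U \<inter> {..j - 1}))" using card_Suc[of "j - 1"] jU Uj by simp
      moreover have "j + 2 < 2 * card U"
      proof -
        have "U \<noteq> {2, 3, 4}" using tj(2) by (auto simp: j_def)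
        then show ?thesis using U unfolding resistant_set_def j_def by blast
      qed
      moreover have "U \<inter> {..j - 1} \<subseteq> {2..j}" using UD(1) by auto
      ultimately show ?thesis using UD(3) jU(3) tj(2) by (intro surplus_node_neg n) auto
    qed
    ultimately have "surplus n k (node_above n k U (j - 1)) < 0"
      using surplus_node_above_step[OF UD(1), of k "j - 1"] jU by simp
    with tj(1) have "surplus n k (node_above n k U t) < 0"
    proof (induction rule: inc_induct)
      case base then show ?case .
    next
      case (step i)
      \<comment> \<open>The prefix is not resistant, which gives
        \<open>2 * card (U \<inter> {..i}) \<le> Suc i\<close>, while \<open>U\<close> itself is,
        which gives \<open>i < 2 * card (U \<inter> {..i})\<close>. So the node is exactly half
        full.\<close>
      have "surplus n k (node n k (U \<inter> {..i}) (Suc i)) = 0" if c: "Suc i \<in> U"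
      proof -
        have "lex_less (U \<inter> {..Suc i}) T"
        proof -
          have "lex_le (U \<inter> {..Suc i}) T" using TU UD step by (intro superset_lex_le) auto
          moreover have "R \<noteq> T" if "Suc i \<in> R" for R using TU that step by auto
          ultimately show ?thesis using c by (auto simp: lex_le_def)
        qed
        moreover have "lex_less U (U \<inter> {..Suc i})"
        proof -
          have "lex_le U (U \<inter> {..Suc i})" using UD by (intro superset_lex_le) auto
          moreover have "j \<in> U" "j \<notin> {..Suc i}" using jU step by auto
          ultimately show ?thesis by (auto simp: lex_le_def)
        qed
        ultimately have nr: "\<not> resistant_set n k (U \<inter> {..Suc i})" using consec by blast
        have pos: "l < 2 * card (U \<inter> {..l})" if "4 \<le> l" "l < j" for l
          using resistant_set_prefix_gt[OF U] that by (simp add: j_def)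
        have "\<not> Suc i + 2 < 2 * card (U \<inter> {..Suc i})"
          using nr resistant_set_prefix[OF UD(1-3) c] pos step t4 tj by fastforce
        then have "2 * card (U \<inter> {..i}) \<le> Suc i" using card_Suc[OF c] by simp
        moreover have "i < 2 * card (U \<inter> {..i})" using pos step t4 tj by simp
        ultimately have "Suc i = 2 * card (U \<inter> {..i})" by simp
        moreover have "card (U \<inter> {..i}) < k"
        proof -
          have "Suc i \<le> j" using step(2) by linarith
          then show ?thesis using card_Suc[OF c] mono[of "Suc i" j] Uj UD(3) by simp
        qed
        moreover have "U \<inter> {..i} \<subseteq> {2..Suc i}" using UD(1) by auto
        ultimately show ?thesis using step(2) jU(3) by (intro surplus_node_zero n) auto
      qed
      then show ?case using surplus_node_above_step[OF UD(1), of k i] step.IH step.prems by auto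
    qed
    then show ?thesis using between_eq_node_above[OF UD(4) TU] by simp
  qed
qed

text \<open>On the relevant prefixes \<open>Y\<close> is the complement of
  \<open>X = first_disjoint n k Y\<close>, and \<open>S\<close> that of \<open>T\<close> except for
  the shared \<open>Max T\<close>. So the first disagreement orders \<open>Y\<close> and
  \<open>S\<close> oppositely to \<open>X\<close> and \<open>T\<close>, and the shared element
  settles agreement up to there.\<close>

lemma resistant_partner:
  assumes T: "resistant_set n k T" and S: "S = insert (Max T) ({1..Max T} - T)"
    and n: "n > 2 * k" and k: "k \<ge> 1" and Y: "Y \<in> nsets {2..n} (k - 1)"
  shows "lex_le Y (S \<inter> {2..n}) \<longleftrightarrow> \<not> lex_le (first_disjoint n k Y) T"
proof -
  note TD = resistant_setD[OF T]
  define j where "j = Max T"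
  define X where "X = first_disjoint n k Y"
  define S' where "S' = S \<inter> {2..n}"
  have S': "S' = insert j ({2..j} - T)" using S TD by (auto simp: S'_def j_def)
  have Xn: "X \<in> nsets {2..n} k" unfolding X_def by (rule first_disjoint_nsets[OF n k Y])
  have X: "X \<subseteq> {2..n}" "finite X" "card X = k" using Xn by (auto simp: nsets_def)
  have Y': "Y \<subseteq> {2..n}" "finite Y" using Y by (auto simp: nsets_def)
  have finS: "finite S'" using S' by simp
  have jT: "j \<in> T" "T \<inter> {..j} = T" "T \<subseteq> {2..j}" "j \<le> n" using TD by (simp_all add: j_def)
  have prefix: "Y \<inter> {..i} = {2..i} - X \<inter> {..i}"
    if "card (X \<inter> {..i}) < k \<or> card (X \<inter> {..i}) = k \<and> i \<in> X" "i \<le> n" for i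
  proof -
    have "X \<inter> {..i} \<subseteq> {2..i}" using X(1) by auto
    then have "first_disjoint n k Y \<inter> {..i} = X \<inter> {..i} \<longleftrightarrow> Y \<inter> {..i} = {2..i} - X \<inter> {..i}"
      using that Y'(1) by (intro first_disjoint_prefix_iff) auto
    then show ?thesis by (simp add: X_def)
  qed
  have "lex_le Y S'" if "\<not> lex_le X T"
  proof -
    have "lex_less T X" using that X TD lex_le_iff_not_less by auto
    then obtain d where d: "d \<in> T" "d \<notin> X" "T \<inter> {..<d} = X \<inter> {..<d}"
      using X TD lex_lessE by metis
    have Xd: "X \<inter> {..d} = T \<inter> {..<d}" using d by (simp add: Int_atMost_lessThan)
    have "card (T \<inter> {..<d}) < card T" using d TD by (intro psubset_card_mono) auto
    moreover have "d \<le> j" using d(1) jT(3) by auto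
    ultimately have Yd: "Y \<inter> {..d} = {2..d} - T \<inter> {..<d}"
      using prefix[of d] Xd TD(3) jT(4) by simp
    have "d \<in> Y \<inter> {..d}" unfolding Yd using d(1) jT(3) by auto
    then have dY: "d \<in> Y" by simp
    show ?thesis
    \<comment> \<open>At \<open>d = j\<close> the shared element makes \<open>S'\<close> the whole
      prefix of \<open>Y\<close>; for \<open>d < j\<close> it is \<open>Y\<close> that has
      \<open>d\<close> and \<open>S'\<close> that lacks it.\<close>
    proof (cases "d = j")
      case True
      have "Y \<inter> {..j} = S'" unfolding Yd[unfolded True] S' using jT by (auto simp: order_le_less)
      then show ?thesis using Y' by (intro superset_lex_le) auto
    next
      case False
      then have "d \<notin> S'" using S' d by simp
      moreover have "Y \<inter> {..<d} = S' \<inter> {..<d}"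
      proof -
        have "Y \<inter> {..<d} = (Y \<inter> {..d}) \<inter> {..<d}" by auto
        also have "\<dots> = S' \<inter> {..<d}" unfolding Yd S' using \<open>d \<le> j\<close> by auto
        finally show ?thesis .
      qed
      ultimately have "lex_less Y S'" using dY Y' finS by (intro lex_lessI[of _ _ d]) auto
      then show ?thesis by (simp add: lex_le_def)
    qed
  qed
  moreover have "lex_less S' Y" if le: "lex_le X T"
  proof (cases "X \<inter> {..j} = T")
    case True
    then have "j \<in> X" using jT(1) by auto
    have "Y \<inter> {..j} = {2..j} - T"
      using prefix[of j, unfolded True] jT(4) TD(3) \<open>j \<in> X\<close> by (metis order_le_less)
    then have Yj: "Y \<inter> {..j} = {2..j} - T" .
    have "j \<notin> Y \<inter> {..j}" unfolding Yj using jT(1) by simp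
    then have "j \<notin> Y" by simp
    moreover have "S' \<inter> {..<j} = Y \<inter> {..<j}"
    proof -
      have "Y \<inter> {..<j} = Y \<inter> {..j} \<inter> {..<j}" by auto
      also have "\<dots> = S' \<inter> {..<j}" unfolding Yj S' by auto
      finally show ?thesis by simp
    qed
    ultimately show ?thesis using Y' finS S' by (intro lex_lessI[of _ _ j]) auto
  next
    case False
    from le X(2) TD(4) show ?thesis
    proof (cases rule: lex_le_lessThan_cases)
      case 1 then show ?thesis using False jT by simp
    next
      case (2 d)
      have "\<not> j < d" using Int_atMost_eq[OF 2(3)] False jT by auto
      then have dj: "d < j" using 2 jT by (metis linorder_neqE_nat)
      have "card (X \<inter> {..d}) \<le> k" using X card_mono[of X "X \<inter> {..d}"] by auto
      then have Yd: "Y \<inter> {..d} = {2..d} - X \<inter> {..d}"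
        using prefix[of d] 2(1) dj jT(4) by (metis order_le_less order_trans less_imp_le)
      have "d \<notin> Y \<inter> {..d}" unfolding Yd using 2 by simp
      moreover have "d \<in> S'" using S' 2 X dj by auto
      moreover have "S' \<inter> {..<d} = Y \<inter> {..<d}"
      proof -
        have "Y \<inter> {..<d} = (Y \<inter> {..d}) \<inter> {..<d}" by auto
        also have "\<dots> = {2..<d} - X \<inter> {..<d}" unfolding Yd by auto
        also have "\<dots> = S' \<inter> {..<d}" unfolding 2(3) S' using dj by auto
        finally show ?thesis by simp
      qed
      ultimately show ?thesis using Y' finS by (intro lex_lessI[of _ _ d]) auto
    qed
  qed
  moreover have "lex_less S' Y \<Longrightarrow> \<not> lex_le Y S'" using lex_le_iff_not_less Y' finS by simp
  ultimately show ?thesis unfolding S'_def X_def by blast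
qed

section \<open>Translation of resistant pairs into resistant sets\<close>

lemma prefix_condition_iff:
  assumes "T \<subseteq> {2..j}" "j \<in> T" "S = insert j ({1..j} - T)"
  shows "i < j \<Longrightarrow> card ({1..i} \<inter> S) < card ({1..i} - S) \<longleftrightarrow> i < 2 * card (T \<inter> {..i})"
    and "card ({1..j} \<inter> S) < card ({1..j} - S) \<longleftrightarrow> j + 2 < 2 * card T"
    and "card S = Suc (j - card T)"
proof -
  have fin: "finite T" using assms finite_subset by blast
  show "card ({1..i} \<inter> S) < card ({1..i} - S) \<longleftrightarrow> i < 2 * card (T \<inter> {..i})" if "i < j"
  proof -
    have "{1..i} \<inter> S = {1..i} - T \<inter> {..i}" "{1..i} - S = T \<inter> {..i}"
      using assms that by auto
    moreover have "card ({1..i} - T \<inter> {..i}) = i - card (T \<inter> {..i})"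
      using assms fin by (subst card_Diff_subset) auto
    moreover have "card (T \<inter> {..i}) \<le> i"
      using assms card_mono[of "{1..i}" "T \<inter> {..i}"] by fastforce
    ultimately show ?thesis by (simp add: less_diff_conv2) linarith
  qed
  have "card ({1..j} - T) = j - card T" using assms fin by (subst card_Diff_subset) auto
  then show cS: "card S = Suc (j - card T)" using assms by simp
  have "{1..j} \<inter> S = S" "{1..j} - S = T - {j}" using assms by auto
  moreover have "card T \<le> j" using assms card_mono[of "{1..j}" T] by fastforce
  moreover have "card (T - {j}) = card T - 1" using fin assms by simp
  ultimately show "card ({1..j} \<inter> S) < card ({1..j} - S) \<longleftrightarrow> j + 2 < 2 * card T"
    using cS by simp linarith
qed

lemma resistant_pair_iff:
  assumes n: "n > 2 * k" and k: "k \<ge> 3"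
  shows "resistant_pair n k S T \<longleftrightarrow> resistant_set n k T \<and> S = insert (Max T) ({1..Max T} - T)"
proof (cases "T = {2, 3, 4}")
  case True
  have M: "Max T = 4" using True by simp
  have part: "S = insert 4 ({1..4} - T) \<longleftrightarrow> S = {1, 4}" using True by auto
  have "S = {1, 4}" if "resistant_pair n k S T"
  proof -
    have "S \<inter> T = {Max T} \<and> S \<union> T = {1..Max T} \<or> S = {1, 4}"
      using that unfolding resistant_pair_def by blast
    then have "S = insert 4 ({1..4} - T) \<or> S = {1, 4}" unfolding M by blast
    then show ?thesis using part by blast
  qed
  moreover have "resistant_pair n k S T" if "S = {1, 4}"
    using n k True that by (simp add: resistant_pair_def)
  moreover have "resistant_set n k T" using n k True by (simp add: resistant_set_def)
  ultimately show ?thesis using part unfolding M by blast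
next
  case False
  define j where "j = Max T"
  show ?thesis
  proof
    assume r: "resistant_pair n k S T"
    then have T: "T \<subseteq> {2..n}" "T \<noteq> {}" and I: "S \<inter> T = {j}" and Un: "S \<union> T = {1..j}"
      and kT: "card T \<le> k" and j4: "4 \<le> j"
      and cond: "\<And>i. 4 \<le> i \<Longrightarrow> i \<le> j \<Longrightarrow> card ({1..i} \<inter> S) < card ({1..i} - S)"
      using False by (auto simp: resistant_pair_def j_def)
    have S: "S = insert j ({1..j} - T)" and jT: "j \<in> T" using I Un by blast+
    have "T \<subseteq> {1..j}" using Un by blast
    then have Tj: "T \<subseteq> {2..j}" using T(1) by fastforce
    note iffs = prefix_condition_iff[OF Tj jT S]
    have last: "j + 2 < 2 * card T" using cond[of j] j4 iffs(2) by simp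
    have pre: "i < 2 * card (T \<inter> {..i})" if "4 \<le> i" "i < j" for i
      using cond[of i] that iffs(1)[of i] by simp
    have "{2, 3, 4} \<subseteq> T"
    proof -
      have sub: "T \<inter> {..4} \<subseteq> {2, 3, 4}" using Tj by auto
      have "4 < 2 * card (T \<inter> {..4})"
      proof (cases "j = 4")
        case True
        then have "T \<inter> {..4} = T" using Tj by auto
        then show ?thesis using last True by simp
      next
        case False then show ?thesis using pre[of 4] j4 by simp
      qed
      then have "T \<inter> {..4} = {2, 3, 4}" by (intro card_seteq sub) auto
      then show ?thesis by auto
    qed
    then show "resistant_set n k T \<and> S = insert (Max T) ({1..Max T} - T)"
      using T kT last pre S by (auto simp: resistant_set_def j_def)
  next
    assume r: "resistant_set n k T \<and> S = insert (Max T) ({1..Max T} - T)"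
    then have rT: "resistant_set n k T" and S: "S = insert j ({1..j} - T)" by (auto simp: j_def)
    note TD = resistant_setD[OF rT]
    have jT: "j \<in> T" and Tj: "T \<subseteq> {2..j}" using TD by (simp_all add: j_def)
    note iffs = prefix_condition_iff[OF Tj jT S]
    have last: "j + 2 < 2 * card T" and pre: "\<And>i. 4 \<le> i \<Longrightarrow> i < j \<Longrightarrow> i < 2 * card (T \<inter> {..i})"
      using rT False by (auto simp: resistant_set_def j_def)
    have "card ({1..i} \<inter> S) < card ({1..i} - S)" if "4 \<le> i" "i \<le> j" for i
      using iffs(1)[of i] iffs(2) pre[of i] last that by (cases "i = j") auto
    moreover have "S \<inter> T = {j}" "S \<union> T = {1..j}" using S jT Tj by auto
    moreover have "card S \<le> k" using iffs(3) last TD(3) by linarith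
    moreover have "S \<subseteq> {1..n}" using S TD by (auto simp: j_def)
    ultimately show "resistant_pair n k S T"
      using TD by (auto simp: resistant_pair_def j_def)
  qed
qed

section \<open>The bounds\<close>

lemma surplus_lex_family_split:
  assumes "U \<subseteq> {2..n}" "T \<subseteq> {2..n}" "lex_le U T"
  shows "surplus n k (lex_family n T k) = surplus n k (lex_family n U k)
           + surplus n k {X \<in> nsets {2..n} k. lex_less U X \<and> lex_le X T}"
proof -
  let ?D = "{X \<in> nsets {2..n} k. lex_less U X \<and> lex_le X T}"
  have fin: "finite U" "finite T" using assms finite_subset by blast+
  have "lex_le X U \<longleftrightarrow> \<not> lex_less U X" "lex_le X U \<Longrightarrow> lex_le X T"
    if "X \<in> nsets {2..n} k" for X
    using finite_nsets_elem[OF that] fin lex_le_iff_not_less lex_le_trans assms(3) by blast+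
  then have "lex_family n T k = lex_family n U k \<union> ?D" "lex_family n U k \<inter> ?D = {}"
    unfolding lex_family_subset_eq[OF assms(1)] lex_family_subset_eq[OF assms(2)] by blast+
  then show ?thesis using surplus_Un[of "lex_family n U k" n k ?D] by (auto simp: lex_family_def)
qed

text \<open>By \<open>resistant_partner\<close>, \<open>lex_family n S (k - 1)\<close> is the
  largest family cross-intersecting \<open>lex_family n T k\<close>, so the total is exactly what
  the surplus measures.\<close>

lemma card_lex_family_resistant:
  assumes "n > 2 * k" "k \<ge> 1" "resistant_set n k T" "S = insert (Max T) ({1..Max T} - T)"
  shows "int (card (lex_family n S (k - 1)) + card (lex_family n T k))
           = int (card (nsets {2..n} (k - 1))) + surplus n k (lex_family n T k)"
proof -
  let ?Y = "{Y \<in> nsets {2..n} (k - 1). first_disjoint n k Y \<in> lex_family n T k}"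
  have "lex_le Y (S \<inter> {2..n}) \<longleftrightarrow> first_disjoint n k Y \<notin> lex_family n T k"
    if "Y \<in> nsets {2..n} (k - 1)" for Y
    using resistant_partner[OF assms(3,4,1,2) that] first_disjoint_nsets[OF assms(1,2) that]
    by (simp add: lex_family_subset_eq[OF resistant_setD(1)[OF assms(3)]])
  then have "lex_family n S (k - 1) = nsets {2..n} (k - 1) - ?Y"
    by (auto simp: lex_family_def[of n S])
  then have "card (lex_family n S (k - 1)) = card (nsets {2..n} (k - 1)) - card ?Y"
    by (simp only:) (intro card_Diff_subset, auto)
  moreover have "card ?Y \<le> card (nsets {2..n} (k - 1))" by (intro card_mono) auto
  ultimately show ?thesis by (simp add: surplus_def)
qed

text \<open>\<open>R\<close> is the last member of the compressed \<open>\<B>\<close>. No member of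
  the compressed \<open>\<A>\<close> may have its least disjoint \<open>k\<close>-set in that
  segment.\<close>

lemma cross_intersecting_surplus_bound:
  assumes n: "n > 2 * k" and k: "k \<ge> 1"
    and "\<A> \<subseteq> nsets {2..n} (k - 1)" "\<B> \<subseteq> nsets {2..n} k" "cross_intersecting \<A> \<B>" "\<B> \<noteq> {}"
  obtains R where "R \<in> nsets {2..n} k" "card \<B> = card (lex_family n R k)"
    "int (card \<A> + card \<B>)
       \<le> int (card (nsets {2..n} (k - 1))) + surplus n k (lex_family n R k)"
proof -
  obtain \<A>' \<B>' where A': "lex_initial {2..n} (k - 1) \<A>'" and B': "lex_initial {2..n} k \<B>'"
    and card: "card \<A>' = card \<A>" "card \<B>' = card \<B>" and cross: "cross_intersecting \<A>' \<B>'"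
    using cross_intersecting_lex_initial[OF _ assms(3-5)] by auto
  have A: "\<A>' \<subseteq> nsets {2..n} (k - 1)" and B: "\<B>' \<subseteq> nsets {2..n} k"
    using A' B' by (auto simp: lex_initial_def)
  have finB: "finite \<B>" "finite \<B>'" using assms B finite_subset finite_nsets_interval by blast+
  then have "\<B>' \<noteq> {}" using assms card by auto
  then have "Max (lex_rank {2..n} ` \<B>') \<in> lex_rank {2..n} ` \<B>'" using finB by (intro Max_in) auto
  then obtain R where RB: "R \<in> \<B>'" and max: "Max (lex_rank {2..n} ` \<B>') = lex_rank {2..n} R"
    by (elim imageE)
  have R: "lex_rank {2..n} X \<le> lex_rank {2..n} R" if "X \<in> \<B>'" for X
    unfolding max[symmetric] using that finB by (intro Max_ge) auto
  have Rn: "R \<in> nsets {2..n} k" using RB B by auto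
  then have R2: "R \<subseteq> {2..n}" by (simp add: nsets_def)
  have "X \<in> \<B>' \<longleftrightarrow> lex_le X R" if X: "X \<in> nsets {2..n} k" for X
  proof
    assume XB: "X \<in> \<B>'"
    have "\<not> lex_less R X"
      using lex_rank_less[of "{2..n}" R X] R[OF XB] X R2 by (auto simp: nsets_def)
    then show "lex_le X R" using X Rn finite_nsets_elem lex_le_iff_not_less by blast
  next
    assume "lex_le X R"
    then show "X \<in> \<B>'" using B' RB X by (auto simp: lex_initial_def lex_le_def)
  qed
  then have eq: "\<B>' = lex_family n R k" using B by (auto simp: lex_family_subset_eq[OF R2])
  let ?Y = "{Y \<in> nsets {2..n} (k - 1). first_disjoint n k Y \<in> \<B>'}"
  have "\<A>' \<inter> ?Y = {}"
    using cross first_disjoint_disjoint unfolding cross_intersecting_def by blast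
  then have "card \<A>' \<le> card (nsets {2..n} (k - 1) - ?Y)" using A by (intro card_mono) auto
  also have "\<dots> = card (nsets {2..n} (k - 1)) - card ?Y" by (intro card_Diff_subset) auto
  finally have "card \<A>' \<le> card (nsets {2..n} (k - 1)) - card ?Y" .
  moreover have "card ?Y \<le> card (nsets {2..n} (k - 1))" by (intro card_mono) auto
  ultimately have "int (card \<A>' + card \<B>') \<le> int (card (nsets {2..n} (k - 1))) + surplus n k \<B>'"
    unfolding surplus_def by linarith
  then show thesis using that Rn card eq by metis
qed

text \<open>\<open>U\<close> stands for the predecessor of \<open>T\<close>; it need not be
  resistant, so that \<open>{2..n}\<close> may take its place. The size bounds become
  \<open>U < R \<le> T\<close> in the order, so no resistant set from \<open>R\<close> on precedes
  \<open>T\<close>, and passing from \<open>R\<close> to \<open>T\<close> does not lower the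
  surplus.\<close>

lemma cross_intersecting_resistant_bound:
  assumes n: "n > 2 * k" and k: "k \<ge> 3" and T: "resistant_set n k T" and U: "U \<subseteq> {2..n}"
    and S: "S = insert (Max T) ({1..Max T} - T)"
    and consec: "\<And>V. resistant_set n k V \<Longrightarrow> lex_less V T \<Longrightarrow> lex_le V U"
    and AB: "\<A> \<subseteq> nsets {2..n} (k - 1)" "\<B> \<subseteq> nsets {2..n} k" "cross_intersecting \<A> \<B>"
    and card: "card (lex_family n U k) < card \<B>" "card \<B> \<le> card (lex_family n T k)"
  shows "card \<A> + card \<B> \<le> card (lex_family n S (k - 1)) + card (lex_family n T k)"
proof -
  have k1: "k \<ge> 1" using k by simp
  have "\<B> \<noteq> {}" using card by auto
  then obtain R where R: "R \<in> nsets {2..n} k" "card \<B> = card (lex_family n R k)"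
    and le: "int (card \<A> + card \<B>)
       \<le> int (card (nsets {2..n} (k - 1))) + surplus n k (lex_family n R k)"
    using cross_intersecting_surplus_bound[OF n k1 AB] by metis
  have R2: "R \<subseteq> {2..n}" using R by (simp add: nsets_def)
  have T2: "T \<subseteq> {2..n}" using resistant_setD[OF T] by simp
  have fin: "finite R" "finite T" "finite U" using R2 T2 U finite_subset by blast+
  note fams = lex_family_subset_eq[OF R2] lex_family_subset_eq[OF T2] lex_family_subset_eq[OF U]
  have RT: "lex_le R T"
  proof (rule ccontr)
    assume "\<not> lex_le R T"
    then have "lex_less T R" using fin lex_le_iff_not_less by blast
    then have "lex_family n T k \<subseteq> lex_family n R k"
      unfolding fams using fin finite_nsets_elem lex_le_less_trans lex_le_def by blast
    moreover have "R \<in> lex_family n R k - lex_family n T k"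
      unfolding fams using R \<open>\<not> lex_le R T\<close> by (simp add: lex_le_def)
    ultimately have "lex_family n T k \<subset> lex_family n R k" by blast
    then have "card (lex_family n T k) < card (lex_family n R k)"
      by (intro psubset_card_mono) (auto simp: lex_family_def)
    then show False using card R by simp
  qed
  have UR: "lex_less U R"
  proof (rule ccontr)
    assume "\<not> lex_less U R"
    then have "lex_le R U" using fin lex_le_iff_not_less by blast
    then have "lex_family n R k \<subseteq> lex_family n U k"
      unfolding fams using fin finite_nsets_elem lex_le_trans by blast
    then have "card (lex_family n R k) \<le> card (lex_family n U k)"
      by (intro card_mono) (auto simp: lex_family_def)
    then show False using card R by simp
  qed
  have "\<not> lex_less V T" if V: "resistant_set n k V" "lex_le R V" for V
  proof
    assume "lex_less V T"
    then have "lex_le V U" by (rule consec[OF V(1)])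
    then have "lex_le R U" using V fin resistant_setD(4)[OF V(1)] lex_le_trans by blast
    then show False using UR fin lex_le_iff_not_less by blast
  qed
  then have "surplus n k {X \<in> nsets {2..n} k. lex_less R X \<and> lex_le X T} \<ge> 0"
    by (intro surplus_up_to_resistant_nonneg n k R T RT)
  then show ?thesis
    using le surplus_lex_family_split[OF R2 T2 RT, of k] card_lex_family_resistant[OF n k1 T S]
    by linarith
qed

lemma intersecting_cross_pair:
  assumes "n \<ge> 1" "\<F> \<subseteq> nsets {1..n} k" "intersecting \<F>"
  obtains \<A> \<B> where "\<A> \<subseteq> nsets {2..n} (k - 1)" "\<B> \<subseteq> nsets {2..n} k"
    "cross_intersecting \<A> \<B>" "card \<A> + card \<B> = card \<F>" "card \<B> = diversity n \<F>"
proof -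
  have finF: "finite \<F>" using assms(2) finite_subset finite_nsets_interval by blast
  have "max_degree n \<F> \<in> (\<lambda>x. card {F \<in> \<F>. x \<in> F}) ` {1..n}"
    unfolding max_degree_def using assms(1) by (intro Max_in) auto
  then obtain x where x: "x \<in> {1..n}" "max_degree n \<F> = card {F \<in> \<F>. x \<in> F}" by auto
  \<comment> \<open>The transposition of 1 and \<open>x\<close>, which carries the ground set
    without \<open>x\<close> to \<open>{2..n}\<close>.\<close>
  define \<sigma> where "\<sigma> z = (if z = 1 then x else if z = x then 1 else z)" for z
  have inj: "inj \<sigma>" by (auto simp: inj_def \<sigma>_def)
  have \<sigma>: "\<sigma> z \<in> {2..n}" if "z \<in> {1..n}" "z \<noteq> x" for z using that x by (auto simp: \<sigma>_def)
  let ?P = "{F \<in> \<F>. x \<in> F}" and ?Q = "{F \<in> \<F>. x \<notin> F}"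
  let ?A = "(\<lambda>F. \<sigma> ` (F - {x})) ` ?P" and ?B = "(`) \<sigma> ` ?Q"
  have F: "F \<subseteq> {1..n}" "finite F" "card F = k" if "F \<in> \<F>" for F
    using that assms(2) by (auto simp: nsets_def)
  have "card ?A = card ?P"
  proof (rule card_image, rule inj_onI)
    fix F G assume FG: "F \<in> ?P" "G \<in> ?P" and "\<sigma> ` (F - {x}) = \<sigma> ` (G - {x})"
    then have "F - {x} = G - {x}" using inj by (simp add: inj_image_eq_iff)
    then show "F = G" using FG by blast
  qed
  moreover have cB: "card ?B = card ?Q"
    using inj by (intro card_image inj_onI) (simp add: inj_image_eq_iff)
  moreover have cF: "card \<F> = card ?P + card ?Q"
  proof -
    have "\<F> = ?P \<union> ?Q" by auto
    then show ?thesis using card_Un_disjoint[of ?P ?Q] finF by auto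
  qed
  ultimately have "card ?A + card ?B = card \<F>" by simp
  moreover have "card ?B = diversity n \<F>" using cB cF x by (simp add: diversity_def)
  moreover have "?A \<subseteq> nsets {2..n} (k - 1)"
  proof clarify
    fix F assume "F \<in> \<F>" "x \<in> F"
    then have "card (\<sigma> ` (F - {x})) = k - 1"
      using F inj by (subst card_image) (auto intro: inj_on_subset)
    moreover have "\<sigma> ` (F - {x}) \<subseteq> {2..n}" using F[OF \<open>F \<in> \<F>\<close>] \<sigma> by blast
    ultimately show "\<sigma> ` (F - {x}) \<in> nsets {2..n} (k - 1)"
      using F[OF \<open>F \<in> \<F>\<close>] by (simp add: nsets_def)
  qed
  moreover have "?B \<subseteq> nsets {2..n} k"
  proof clarify
    fix F assume "F \<in> \<F>" "x \<notin> F"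
    then have "card (\<sigma> ` F) = k"
      using F inj by (subst card_image) (auto intro: inj_on_subset)
    moreover have "\<sigma> ` F \<subseteq> {2..n}" using F[OF \<open>F \<in> \<F>\<close>] \<sigma> \<open>x \<notin> F\<close> by blast
    ultimately show "\<sigma> ` F \<in> nsets {2..n} k"
      using F[OF \<open>F \<in> \<F>\<close>] by (simp add: nsets_def)
  qed
  moreover have "cross_intersecting ?A ?B"
    unfolding cross_intersecting_def
  proof clarify
    fix F G assume FG: "F \<in> \<F>" "x \<in> F" "G \<in> \<F>" "x \<notin> G" and "\<sigma> ` (F - {x}) \<inter> \<sigma> ` G = {}"
    then have "(F - {x}) \<inter> G = {}" by blast
    then have "F \<inter> G = {}" using FG by blast
    then show False using assms(3) FG unfolding intersecting_def by blast
  qed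
  ultimately show thesis by (intro that[of ?A ?B])
qed

theorem theorem8:
  fixes n k m :: nat and S T :: "nat \<Rightarrow> nat set"
  assumes "n > 2 * k" and "2 * k \<ge> 6"
    and all_pairs: "bij_betw (\<lambda>l. (S l, T l)) {1..m} {(S', T'). resistant_pair n k S' T'}"
    and ordered: "\<And>i j. 1 \<le> i \<Longrightarrow> i < j \<Longrightarrow> j \<le> m \<Longrightarrow> lex_less (T i) (T j)"
    and T0: "T 0 = {2..n}" and S0: "S 0 = {1}"
  shows "(\<forall>l\<in>{1..m}.
            card (lex_family n (S (l - 1)) (k - 1)) + card (lex_family n (T (l - 1)) k)
              > card (lex_family n (S l) (k - 1)) + card (lex_family n (T l) k))
       \<and> (\<forall>l\<in>{1..m}. \<forall>\<A> \<B>.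
            \<A> \<subseteq> nsets {2..n} (k - 1) \<and> \<B> \<subseteq> nsets {2..n} k \<and> cross_intersecting \<A> \<B> \<and>
            card (lex_family n (T (l - 1)) k) < card \<B> \<and> card \<B> \<le> card (lex_family n (T l) k)
            \<longrightarrow> card \<A> + card \<B>
                  \<le> card (lex_family n (S l) (k - 1)) + card (lex_family n (T l) k))
       \<and> (\<forall>l\<in>{1..m}. \<forall>\<F>.
            \<F> \<subseteq> nsets {1..n} k \<and> intersecting \<F> \<and>
            card (lex_family n (T (l - 1)) k) < diversity n \<F> \<and>
            diversity n \<F> \<le> card (lex_family n (T l) k)
            \<longrightarrow> card \<F>
                  \<le> card (lex_family n (S l) (k - 1)) + card (lex_family n (T l) k))"
proof -
  note n = \<open>n > 2 * k\<close>
  have k: "k \<ge> 3" and k1: "k \<ge> 1" using \<open>2 * k \<ge> 6\<close> by auto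
  have image: "(\<lambda>l. (S l, T l)) ` {1..m} = {(S', T'). resistant_pair n k S' T'}"
    using all_pairs by (simp add: bij_betw_def)
  have res: "resistant_set n k (T l)" "S l = insert (Max (T l)) ({1..Max (T l)} - T l)"
    if "l \<in> {1..m}" for l
  proof -
    have "(S l, T l) \<in> {(S', T'). resistant_pair n k S' T'}" using that image by blast
    then show "resistant_set n k (T l)" "S l = insert (Max (T l)) ({1..Max (T l)} - T l)"
      by (simp_all add: resistant_pair_iff[OF n k])
  qed
  have index: "\<exists>q\<in>{1..m}. V = T q" if "resistant_set n k V" for V
  proof -
    have "(insert (Max V) ({1..Max V} - V), V) \<in> {(S', T'). resistant_pair n k S' T'}"
      using that by (simp add: resistant_pair_iff[OF n k])
    then show ?thesis using image by blast
  qed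
  have pred: "\<exists>q. 1 \<le> q \<and> q < l \<and> V = T q"
    if l: "l \<in> {1..m}" and V: "resistant_set n k V" "lex_less V (T l)" for V l
  proof -
    obtain q where q: "q \<in> {1..m}" "V = T q" using index[OF V(1)] by blast
    have "\<not> lex_less (T l) V"
      using V lex_less_asym resistant_setD(4)[OF res(1)[OF l]] resistant_setD(4)[OF V(1)] by blast
    then have "\<not> l < q" using ordered[of l q] q l by auto
    moreover have "q \<noteq> l" using V q by auto
    ultimately show ?thesis using q by auto
  qed
  \<comment> \<open>Consecutiveness in the form that the bound needs. For \<open>l = 1\<close> it is
    vacuous, so \<open>T 0\<close> needs no place among the resistant sets.\<close>
  have le_pred: "lex_le V (T (l - 1))"
    if l: "l \<in> {1..m}" and V: "resistant_set n k V" "lex_less V (T l)" for V l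
  proof -
    obtain q where "1 \<le> q" "q < l" "V = T q" using pred[OF l V] by blast
    then show ?thesis
      using ordered[of q "l - 1"] l by (cases "q = l - 1") (auto simp: lex_le_def)
  qed
  have sub: "T (l - 1) \<subseteq> {2..n}" if "l \<in> {1..m}" for l
  proof (cases "l = 1")
    case True then show ?thesis using T0 by simp
  next
    case False
    then have "l - 1 \<in> {1..m}" using that by auto
    then show ?thesis by (rule resistant_setD(1)[OF res(1)])
  qed
  have i: "card (lex_family n (S (l - 1)) (k - 1)) + card (lex_family n (T (l - 1)) k)
              > card (lex_family n (S l) (k - 1)) + card (lex_family n (T l) k)"
    if l: "l \<in> {1..m}" for l
  proof (cases "l = 1")
    \<comment> \<open>With \<open>S 0\<close> and \<open>T 0\<close> the left side is the constant
      \<open>card (nsets {2..n} (k - 1))\<close>, so the claim is that the first segment has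
      negative surplus.\<close>
    case True
    have "\<not> lex_less V (T l)" if "resistant_set n k V" for V
      using pred[OF l that] True by auto
    then have "surplus n k (lex_family n (T l) k) < 0"
      using surplus_first_resistant_neg[OF n res(1)[OF l]]
      by (simp add: lex_family_subset_eq resistant_setD(1)[OF res(1)[OF l]])
    moreover have "lex_family n (S 0) (k - 1) = nsets {2..n} (k - 1)"
      using superset_lex_le[of "{}"] finite_nsets_elem by (auto simp: lex_family_def S0)
    moreover have "lex_family n (T 0) k = {}"
    proof -
      have False if "X \<in> nsets {2..n} k" "lex_le X {2..n}" for X
      proof -
        have X: "finite X" "X \<subseteq> {2..n}" "card X = k" using that by (auto simp: nsets_def)
        then have "\<not> lex_less X {2..n}"
          using superset_lex_le[of X "{2..n}"] lex_le_iff_not_less by auto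
        moreover have "X \<noteq> {2..n}" using X n k by auto
        ultimately show False using that by (simp add: lex_le_def)
      qed
      then show ?thesis by (auto simp: lex_family_def T0)
    qed
    ultimately show ?thesis
      using card_lex_family_resistant[OF n k1 res[OF l]] True by simp
  next
    case False
    then have l': "l - 1 \<in> {1..m}" using l by auto
    have lt: "lex_less (T (l - 1)) (T l)" using ordered[of "l - 1" l] l l' by auto
    note r = res(1)[OF l] and r' = res(1)[OF l']
    have "\<not> lex_less V (T l)" if V: "resistant_set n k V" "lex_less (T (l - 1)) V" for V
      using le_pred[OF l V(1)] V(2) lex_le_iff_not_less resistant_setD(4)[OF V(1)]
        resistant_setD(4)[OF r'] by blast
    then have "surplus n k {X \<in> nsets {2..n} k. lex_less (T (l - 1)) X \<and> lex_le X (T l)} < 0"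
      by (intro surplus_between_resistant_neg n r r' lt)
    moreover have "lex_le (T (l - 1)) (T l)" using lt by (simp add: lex_le_def)
    ultimately show ?thesis
      using card_lex_family_resistant[OF n k1 res[OF l]]
        card_lex_family_resistant[OF n k1 res[OF l']]
        surplus_lex_family_split[OF resistant_setD(1)[OF r'] resistant_setD(1)[OF r], of k]
      by linarith
  qed
  have ii: "card \<A> + card \<B> \<le> card (lex_family n (S l) (k - 1)) + card (lex_family n (T l) k)"
    if l: "l \<in> {1..m}" and "\<A> \<subseteq> nsets {2..n} (k - 1)" "\<B> \<subseteq> nsets {2..n} k"
      "cross_intersecting \<A> \<B>" "card (lex_family n (T (l - 1)) k) < card \<B>"
      "card \<B> \<le> card (lex_family n (T l) k)" for l \<A> \<B>
    using cross_intersecting_resistant_bound[OF n k res(1)[OF l] sub[OF l] res(2)[OF l]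
        le_pred[OF l] that(2-6)] .
  have iii: "card \<F> \<le> card (lex_family n (S l) (k - 1)) + card (lex_family n (T l) k)"
    if l: "l \<in> {1..m}" and F: "\<F> \<subseteq> nsets {1..n} k" "intersecting \<F>"
      and div: "card (lex_family n (T (l - 1)) k) < diversity n \<F>"
      "diversity n \<F> \<le> card (lex_family n (T l) k)" for l \<F>
  proof -
    have "n \<ge> 1" using n by simp
    then obtain \<A> \<B> where "\<A> \<subseteq> nsets {2..n} (k - 1)" "\<B> \<subseteq> nsets {2..n} k"
      "cross_intersecting \<A> \<B>" "card \<A> + card \<B> = card \<F>" "card \<B> = diversity n \<F>"
      using intersecting_cross_pair F by metis
    then show ?thesis using ii[OF l, of \<A> \<B>] div by simp
  qed
  show ?thesis using i ii iii by blast
qed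

end
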